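(* Let $p \geq 5$ be a prime and define $$w_2(p):= a_2\left( \frac{3(p^2-1)}{8}\right) + p^2 \left( \frac{-6}{p}\right)_{L} \left( \frac{-3(p^2-1)/8}{p}\right)_{L}.$$ (i) If $w_2(p) \equiv 0 \pmod2$, then for all integers $n,k \geq 0$ with $p \nmid n$, $B_{8,3} \left( p^{4k+3}n+ \frac{3 ( p^{4k+4}-1)}{8} \right) \equiv 0 \pmod2$. (ii) If $w_2(p) \not \equiv 0 \pmod2$, then for all integers $n,k \geq 0$ with $p \nmid n$, $B_{8,3} \left( p^{6k+5}n+ \frac{3 ( p^{6k+6}-1)}{8} \right) \equiv 0 \pmod2$. (iii) If $w_2(p) \not \equiv 0 \pmod2$, then for all integers $n,k \geq 0$ with $w_2(p)\equiv p^2 \left( \frac{ -6n-2+ \frac{p^2-1}{4}}{p}\right)_{L}\pmod2$, $B_{8,3} \left( p^{6k+2}n+ \frac{3 ( p^{6k+2}-1)}{8} \right) \equiv 0 \pmod2$.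
   Context: $a_2(n)$ is defined by $\sum_{n\ge0}a_2(n)q^n=(q;q)_\infty^6(q^3;q^3)_\infty$, where $(q^t;q^t)_\infty=\prod_{k\ge1}(1-q^{tk})$. $\left(\frac{a}{p}\right)_L$ is the Legendre symbol ($0$ if $p\mid a$). For integers $u,v\ge 2$, $B_{u,v}(n)$ is the number of bipartitions $(\alpha,\beta)$ of $n$ with $\alpha$ having no part divisible by $u$ and $\beta$ having no part divisible by $v$; $\sum_{n\ge0}B_{u,v}(n)q^n=\frac{(q^u;q^u)_\infty(q^v;q^v)_\infty}{(q;q)_\infty^2}$. *)

theory Defs
  imports
    "HOL-Analysis.Infinite_Products"
    "HOL-Computational_Algebra.Formal_Power_Series"
    "HOL-Number_Theory.Residues"
    "HOL-Library.Multiset"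
begin

text \<open>
  \<open>euler_fps t\<close> is the product of \<open>1 - q\<^sup>t\<^sup>k\<close> over \<open>k \<ge> 1\<close> as a formal power series; the infinite
  product is the library's, taken with respect to the \<open>q\<close>-adic metric on power series.
\<close>

definition euler_fps :: "nat \<Rightarrow> int fps" where
  "euler_fps t = (\<Prod>k. 1 - fps_X ^ (t * Suc k))"

definition a2 :: "nat \<Rightarrow> int" where
  "a2 n = fps_nth (euler_fps 1 ^ 6 * euler_fps 3) n"

text \<open>
  A partition is the multiset of its parts. \<open>bipart_count u v\<close> is the function usually
  written \<open>B\<close> with index \<open>u, v\<close>.
\<close>

definition regular_partition :: "nat \<Rightarrow> nat multiset \<Rightarrow> bool" where
  "regular_partition u \<alpha> \<longleftrightarrow> (\<forall>x\<in>#\<alpha>. 0 < x \<and> \<not> u dvd x)"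

definition bipart_count :: "nat \<Rightarrow> nat \<Rightarrow> nat \<Rightarrow> nat" where
  "bipart_count u v n = card {(\<alpha>, \<beta>). regular_partition u \<alpha> \<and> regular_partition v \<beta> \<and>
                                       sum_mset \<alpha> + sum_mset \<beta> = n}"

text \<open>The divisions by 8 are exact when \<open>p\<close> is odd.\<close>

definition w2 :: "nat \<Rightarrow> int" where
  "w2 p = a2 (3 * (p\<^sup>2 - 1) div 8)
     + (int p)\<^sup>2 * Legendre (-6) (int p) * Legendre (- (3 * ((int p)\<^sup>2 - 1) div 8)) (int p)"

text \<open>
  The two facts below justify that the definitions above do not hit a default value: the infinite
  product converges, and the set counted by \<^const>\<open>bipart_count\<close> is finite.
\<close>

lemma euler_fps_has_prod:
  assumes "t > 0"
  shows "(\<lambda>k. 1 - fps_X ^ (t * Suc k) :: int fps) has_prod euler_fps t"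
proof -
  let ?P = "\<lambda>n. (\<Prod>k\<le>n. 1 - fps_X ^ (t * Suc k)) :: int fps"
  have step: "fps_nth (?P (Suc n)) i = fps_nth (?P n) i" if "i \<le> n" for n i
  proof -
    have "Suc (Suc n) \<le> t * Suc (Suc n)"
      using mult_le_mono1[of 1 t "Suc (Suc n)"] assms by simp
    then have "i < t * Suc (Suc n)"
      using that by linarith
    moreover have "?P (Suc n) = ?P n - ?P n * fps_X ^ (t * Suc (Suc n))"
      by (simp add: algebra_simps)
    ultimately show ?thesis
      by (simp only: fps_sub_nth fps_X_power_mult_right_nth) simp
  qed
  have stable: "fps_nth (?P (i + m)) i = fps_nth (?P i) i" for i m
  proof (induction m)
    case (Suc m)
    show ?case using step[of i "i + m"] Suc by simp
  qed simp
  define F where "F = Abs_fps (\<lambda>i. fps_nth (?P i) i)"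
  have lim: "?P \<longlonglongrightarrow> F"
  proof (rule tendsto_fpsI)
    fix i
    have "fps_nth (?P n) i = fps_nth F i" if "n \<ge> i" for n
      using stable[of i "n - i"] that by (simp add: F_def)
    then show "\<forall>\<^sub>F n in sequentially. fps_nth (?P n) i = fps_nth F i"
      by (auto simp: eventually_sequentially)
  qed
  have "fps_nth F 0 = 1" using assms by (simp add: F_def)
  then have "F \<noteq> 0" by auto
  with lim have "(\<lambda>k. 1 - fps_X ^ (t * Suc k) :: int fps) has_prod F"
    by (auto simp: has_prod_def raw_has_prod_def)
  then show ?thesis
    unfolding euler_fps_def using has_prod_unique by metis
qed

lemma finite_bipart_set:
  "finite {(\<alpha>, \<beta>). regular_partition u \<alpha> \<and> regular_partition v \<beta> \<and> sum_mset \<alpha> + sum_mset \<beta> = n}"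
proof -
  have size_le: "size \<alpha> \<le> sum_mset \<alpha>" if "\<forall>x\<in>#\<alpha>. 0 < x" for \<alpha> :: "nat multiset"
    using that by (induction \<alpha>) auto
  let ?S = "\<Union>k\<le>n. multisets_of_size {..n} k"
  have "\<alpha> \<in> ?S" if "regular_partition w \<alpha>" "sum_mset \<alpha> \<le> n" for w \<alpha>
  proof -
    have "x \<le> n" if "x \<in># \<alpha>" for x
      using \<open>sum_mset \<alpha> \<le> n\<close> sum_mset.remove[OF that] by simp
    moreover have "size \<alpha> \<le> n"
      using size_le[of \<alpha>] that by (auto simp: regular_partition_def)
    ultimately show ?thesis by (auto simp: multisets_of_size_def)
  qed
  then have "{(\<alpha>, \<beta>). regular_partition u \<alpha> \<and> regular_partition v \<beta> \<and> sum_mset \<alpha> + sum_mset \<beta> = n}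
      \<subseteq> ?S \<times> ?S"
    by fastforce
  moreover have "finite ?S"
    by auto
  ultimately show ?thesis by (meson finite_SigmaI finite_subset)
qed

end

theory Submission
  imports Defs "HOL-Library.Discrete_Functions" "HOL-Library.Z2"
begin

text \<open>
  Write \<open>E t\<close> for the Euler product in \<open>q\<^sup>t\<close>. Modulo \<open>2\<close> we have \<open>E 8 = (E 1)\<^sup>8\<close>, so \<open>B\<close> with index \<open>8, 3\<close>
  and \<open>a\<^sub>2\<close> both have generating function \<open>(E 1)\<^sup>6 E 3 = (E 2)\<^sup>3 E 3\<close>, a product of the theta series of
  the triangular and of the pentagonal numbers. Hence their values at \<open>n\<close> have the parity of the number of
  positive solutions of \<open>2x\<^sup>2 + y\<^sup>2 = 8n + 3\<close> with \<open>3 \<nmid> y\<close>. This number is governed by the arithmetic of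
  \<open>\<int>[\<surd>-2]\<close>: the solutions not divisible by a prime \<open>p \<ge> 5\<close> are equally many for \<open>M\<close> and \<open>p M\<close>
  when \<open>p\<close> divides \<open>M\<close>. For \<open>M = 3p\<^sup>2\<close> this gives an odd number of solutions, so \<open>w\<^sub>2(p)\<close> is always even
  and only (i) has content; there \<open>M\<close> is exactly divisible by \<open>p\<^bsup>4k+3\<^esup>\<close>, which makes
  the number of solutions a multiple of \<open>2(k + 1)\<close>.
\<close>

section \<open>Generating functions\<close>

definition euler_prod :: "nat \<Rightarrow> nat \<Rightarrow> 'a::comm_ring_1 fps" where
  "euler_prod t m = (\<Prod>k=1..m. 1 - fps_X ^ (t * k))"

text \<open>This is congruence modulo \<open>q ^ (n + 1)\<close>, which lets finite products replace
  infinite ones.\<close>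

definition fps_agree :: "nat \<Rightarrow> 'a fps \<Rightarrow> 'a fps \<Rightarrow> bool" where
  "fps_agree n f g \<longleftrightarrow> (\<forall>i\<le>n. fps_nth f i = fps_nth g i)"

lemma fps_agree_refl [simp]: "fps_agree n f f"
  by (simp add: fps_agree_def)

lemma fps_agree_sym: "fps_agree n f g \<Longrightarrow> fps_agree n g f"
  by (simp add: fps_agree_def)

lemma fps_agree_trans [trans]: "fps_agree n f g \<Longrightarrow> fps_agree n g h \<Longrightarrow> fps_agree n f h"
  by (simp add: fps_agree_def)

lemma fps_agree_mult:
  fixes f g f' g' :: "'a::comm_ring_1 fps"
  shows "fps_agree n f f' \<Longrightarrow> fps_agree n g g' \<Longrightarrow> fps_agree n (f * g) (f' * g')"
  by (auto simp: fps_agree_def fps_mult_nth intro!: sum.cong)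

lemma fps_agree_power:
  fixes f g :: "'a::comm_ring_1 fps"
  shows "fps_agree n f g \<Longrightarrow> fps_agree n (f ^ k) (g ^ k)"
  by (induction k) (auto intro: fps_agree_mult)

lemma fps_agree_all: "(\<And>n. fps_agree n f g) \<Longrightarrow> f = g"
  by (auto simp: fps_agree_def fps_eq_iff)

lemma fps_agree_mult_one_minus:
  fixes f :: "'a::comm_ring_1 fps"
  assumes "n < k"
  shows "fps_agree n (f * (1 - fps_X ^ k)) f"
  using assms by (simp add: fps_agree_def right_diff_distrib fps_X_power_mult_right_nth)

lemma fps_agree_mult_X_power:
  fixes f :: "'a::comm_ring_1 fps"
  assumes "n < k"
  shows "fps_agree n (f * fps_X ^ k) 0"
  using assms by (simp add: fps_agree_def fps_X_power_mult_right_nth)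

lemma fps_agree_sum:
  fixes f :: "'b \<Rightarrow> 'a::comm_ring_1 fps"
  assumes "\<And>x. x \<in> A \<Longrightarrow> fps_agree n (f x) (g x)"
  shows "fps_agree n (sum f A) (sum g A)"
  using assms by (auto simp: fps_agree_def fps_sum_nth intro!: sum.cong)

text \<open>Every further factor is \<open>1 - q ^ (t * k)\<close> with \<open>k > m\<close>, whose
  exponent exceeds \<open>n\<close>.\<close>

lemma euler_prod_agree:
  assumes "n < t * Suc m" "m \<le> m'"
  shows "fps_agree n (euler_prod t m' :: 'a::comm_ring_1 fps) (euler_prod t m)"
  using assms(2)
proof (induction m' rule: dec_induct)
  case (step i)
  have "t * Suc m \<le> t * Suc i" using step by simp
  with assms(1) have "n < t * Suc i" by linarith
  then have "fps_agree n (euler_prod t (Suc i)) (euler_prod t i :: 'a fps)"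
    using fps_agree_mult_one_minus[of n "t * Suc i" "euler_prod t i :: 'a fps"]
    by (simp add: euler_prod_def mult.commute)
  then show ?case using step fps_agree_trans by blast
qed simp

text \<open>Convergence makes each coefficient eventually constant, and late partial products
  already agree with \<open>euler_prod t m\<close>.\<close>

lemma euler_fps_agree:
  assumes "n < t * Suc m"
  shows "fps_agree n (euler_fps t) (euler_prod t m)"
proof -
  have "t > 0" using assms by (cases t) auto
  then have "(\<lambda>N. \<Prod>k\<le>N. 1 - fps_X ^ (t * Suc k) :: int fps) \<longlonglongrightarrow> euler_fps t"
    using euler_fps_has_prod by (intro has_prod_imp_tendsto) auto
  also have "(\<lambda>N. \<Prod>k\<le>N. 1 - fps_X ^ (t * Suc k) :: int fps) = (\<lambda>N. euler_prod t (Suc N))"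
    by (simp only: euler_prod_def prod.atLeast_Suc_atMost_Suc_shift atLeast0AtMost One_nat_def comp_def)
  finally have lim: "(\<lambda>N. euler_prod t (Suc N) :: int fps) \<longlonglongrightarrow> euler_fps t" .
  show ?thesis unfolding fps_agree_def
  proof (intro allI impI)
    fix i assume "i \<le> n"
    have "\<forall>\<^sub>F N in sequentially. fps_nth (euler_prod t (Suc N)) i = fps_nth (euler_fps t) i"
      using lim by (simp add: tendsto_fps_iff)
    moreover have "\<forall>\<^sub>F N in sequentially. m \<le> N" by (rule eventually_ge_at_top)
    ultimately have "\<forall>\<^sub>F N in sequentially. m \<le> N \<and> fps_nth (euler_prod t (Suc N)) i = fps_nth (euler_fps t) i"
      by eventually_elim auto
    then obtain N where "m \<le> N" "fps_nth (euler_prod t (Suc N)) i = fps_nth (euler_fps t) i"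
      by (auto simp: eventually_sequentially)
    then show "fps_nth (euler_fps t) i = fps_nth (euler_prod t m) i"
      using euler_prod_agree[OF assms, of "Suc N"] \<open>i \<le> n\<close> by (metis fps_agree_def le_SucI)
  qed
qed

section \<open>Generating functions of partitions with prescribed parts\<close>

definition parts_gf :: "nat set \<Rightarrow> 'a::comm_ring_1 fps" where
  "parts_gf A = Abs_fps (\<lambda>n. of_nat (card {\<alpha>. set_mset \<alpha> \<subseteq> A \<and> sum_mset \<alpha> = n}))"

lemma finite_msets_sum:
  fixes n :: nat
  assumes "0 \<notin> A"
  shows "finite {\<alpha>. set_mset \<alpha> \<subseteq> A \<and> sum_mset \<alpha> = n}"
proof (rule finite_subset)
  have "size \<alpha> \<le> sum_mset \<alpha>" if "0 \<notin># \<alpha>" for \<alpha> :: "nat multiset"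
    using that by (induction \<alpha>) auto
  moreover have "x \<le> sum_mset \<alpha>" if "x \<in># \<alpha>" for x and \<alpha> :: "nat multiset"
    using sum_mset.remove[OF that] by simp
  ultimately have "\<alpha> \<in> multisets_of_size {..n} (size \<alpha>)" "size \<alpha> \<le> n"
    if "set_mset \<alpha> \<subseteq> A" "sum_mset \<alpha> = n" for \<alpha>
    using that assms by (auto simp: multisets_of_size_def)
  then show "{\<alpha>. set_mset \<alpha> \<subseteq> A \<and> sum_mset \<alpha> = n} \<subseteq> (\<Union>k\<le>n. multisets_of_size {..n} k)"
    by blast
qed auto

text \<open>A multiset over \<open>insert a A\<close> with sum \<open>n\<close> either avoids
  \<open>a\<close> or arises from one with sum \<open>n - a\<close> by adding a copy of
  \<open>a\<close>. On coefficients, the factor \<open>1 - fps_X ^ a\<close> expresses this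
  recurrence.\<close>

lemma parts_gf_insert:
  assumes "0 \<notin> A" "a > 0" "a \<notin> A"
  shows "parts_gf (insert a A) * (1 - fps_X ^ a) = (parts_gf A :: 'a::comm_ring_1 fps)"
proof (rule fps_ext)
  fix n
  let ?S = "\<lambda>B n. {\<alpha> :: nat multiset. set_mset \<alpha> \<subseteq> B \<and> sum_mset \<alpha> = n}"
  have fin: "finite (?S (insert a A) n)" for n using assms by (intro finite_msets_sum) auto
  have "card (?S (insert a A) n) = card (?S A n) + (if a \<le> n then card (?S (insert a A) (n - a)) else 0)"
  proof -
    have "?S (insert a A) n = ?S A n \<union> {\<alpha> \<in> ?S (insert a A) n. a \<in># \<alpha>}" by auto
    moreover have "?S A n \<inter> {\<alpha> \<in> ?S (insert a A) n. a \<in># \<alpha>} = {}" using assms by auto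
    moreover have "finite (?S A n)" using assms by (intro finite_msets_sum)
    ultimately have "card (?S (insert a A) n) = card (?S A n) + card {\<alpha> \<in> ?S (insert a A) n. a \<in># \<alpha>}"
      using fin[of n] by (metis (no_types, lifting) card_Un_disjoint finite_Un)
    moreover have "{\<alpha> \<in> ?S (insert a A) n. a \<in># \<alpha>} =
        (if a \<le> n then add_mset a ` ?S (insert a A) (n - a) else {})"
    proof (intro equalityI subsetI)
      fix \<alpha> assume \<alpha>: "\<alpha> \<in> {\<alpha> \<in> ?S (insert a A) n. a \<in># \<alpha>}"
      then have "a \<in># \<alpha>" by simp
      then obtain \<beta> where \<beta>: "\<alpha> = add_mset a \<beta>" by (rule mset_add)
      then have "a \<le> n" "\<beta> \<in> ?S (insert a A) (n - a)" using \<alpha> by auto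
      then show "\<alpha> \<in> (if a \<le> n then add_mset a ` ?S (insert a A) (n - a) else {})" using \<beta> by simp
    qed (auto split: if_splits)
    moreover have "inj_on (add_mset a) B" for B by (simp add: inj_on_def)
    ultimately show ?thesis by (simp add: card_image)
  qed
  then show "fps_nth (parts_gf (insert a A) * (1 - fps_X ^ a)) n = fps_nth (parts_gf A :: 'a fps) n"
    by (simp add: parts_gf_def right_diff_distrib fps_X_power_mult_right_nth)
qed

lemma parts_gf_empty: "parts_gf {} = (1 :: 'a::comm_ring_1 fps)"
proof (rule fps_ext)
  fix n :: nat
  have "{\<alpha>. set_mset \<alpha> \<subseteq> {} \<and> sum_mset \<alpha> = n} = (if n = 0 then {{#}} else {})" by auto
  then show "fps_nth (parts_gf {} :: 'a fps) n = fps_nth 1 n" by (simp add: parts_gf_def)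
qed

lemma parts_gf_prod:
  assumes "finite A" "0 \<notin> A"
  shows "parts_gf A * (\<Prod>a\<in>A. 1 - fps_X ^ a) = (1 :: 'a::comm_ring_1 fps)"
  using assms
proof (induction A)
  case (insert a A)
  then show ?case
    using parts_gf_insert[of A a, where 'a = 'a] by (simp add: mult.assoc[symmetric])
qed (simp add: parts_gf_empty)

text \<open>No part of a partition of \<open>i \<le> n\<close> exceeds \<open>n\<close>. The cut to
  finitely many part sizes makes \<open>parts_gf_prod\<close> applicable.\<close>

lemma regular_gf_agree:
  "fps_agree n (parts_gf {x. 0 < x \<and> \<not> u dvd x} :: 'a::comm_ring_1 fps)
     (parts_gf {x. 0 < x \<and> x \<le> n \<and> \<not> u dvd x})"
proof -
  have "x \<le> sum_mset \<alpha>" if "x \<in># \<alpha>" for x and \<alpha> :: "nat multiset"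
    using sum_mset.remove[OF that] by simp
  then have "{\<alpha>. set_mset \<alpha> \<subseteq> {x. 0 < x \<and> \<not> u dvd x} \<and> sum_mset \<alpha> = i} =
        {\<alpha>. set_mset \<alpha> \<subseteq> {x. 0 < x \<and> x \<le> n \<and> \<not> u dvd x} \<and> sum_mset \<alpha> = i}" if "i \<le> n" for i
    using that by fastforce
  then show ?thesis by (simp add: fps_agree_def parts_gf_def)
qed

lemma bipart_gf:
  "of_nat (bipart_count u v n) = fps_nth (parts_gf {x. 0 < x \<and> \<not> u dvd x} *
     parts_gf {x. 0 < x \<and> \<not> v dvd x} :: 'a::comm_ring_1 fps) n"
proof -
  let ?S = "\<lambda>u n. {\<alpha> :: nat multiset. set_mset \<alpha> \<subseteq> {x. 0 < x \<and> \<not> u dvd x} \<and> sum_mset \<alpha> = n}"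
  have fin: "finite (?S u n)" for u n by (rule finite_msets_sum) simp
  have "{(\<alpha>, \<beta>). regular_partition u \<alpha> \<and> regular_partition v \<beta> \<and> sum_mset \<alpha> + sum_mset \<beta> = n}
      = (\<Union>i\<in>{0..n}. ?S u i \<times> ?S v (n - i))"
    by (auto simp: regular_partition_def)
  then have "bipart_count u v n = (\<Sum>i=0..n. card (?S u i \<times> ?S v (n - i)))"
    unfolding bipart_count_def using fin by (simp only:) (subst card_UN_disjoint; auto)
  then show ?thesis by (simp add: fps_mult_nth parts_gf_def card_cartesian_product)
qed

section \<open>Finite theta identities\<close>

text \<open>
  Shanks's finite forms of Euler's and Gauss's theta identities: consecutive left-hand sides
  differ by a telescoping sum. The triangular one is multiplied through by \<open>\<Prod>k=1..n. 1 - q ^ (2 * k - 1)\<close>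
  to avoid division.
\<close>

lemma shanks_pentagonal:
  fixes q :: "'a::comm_ring_1"
  shows "(\<Sum>s\<le>n. (-1) ^ s * (\<Prod>k=Suc s..n. 1 - q ^ k) * q ^ (s * n + s * Suc s div 2)) =
    1 + (\<Sum>s=1..n. (-1) ^ s * (q ^ (s * (3 * s + 1) div 2) + q ^ (s * (3 * s - 1) div 2)))"
proof (induction n)
  case (Suc n)
  define P where "P = (\<lambda>s. \<Prod>k=Suc s..n. 1 - q ^ k)"
  define e where "e = (\<lambda>s. s * n + s * Suc s div 2)"
  have e_Suc: "e (Suc s) = e s + n + Suc s" for s
  proof -
    have "Suc s * Suc (Suc s) = s * Suc s + 2 * Suc s" by simp
    then have "Suc s * Suc (Suc s) div 2 = s * Suc s div 2 + Suc s" by simp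
    then show ?thesis by (simp add: e_def)
  qed
  have P_Suc: "P s = (1 - q ^ Suc s) * P (Suc s)" if "s < n" for s
    unfolding P_def using that by (subst prod.atLeast_Suc_atMost) auto
  \<comment> \<open>By \<open>P_Suc\<close> and \<open>e_Suc\<close> the summand of index
    \<open>s \<ge> 1\<close> in \<open>telescope\<close> is \<open>t (s - 1) - t s\<close>.\<close>
  define t where "t = (\<lambda>s. (-1) ^ s * P s * q ^ (e s + s + Suc n))"
  have telescope: "(\<Sum>s\<le>m. (-1) ^ s * P s * ((1 - q ^ Suc n) * q ^ (e s + s) - q ^ e s)) = - t m"
    if "m \<le> n" for m
    using that
  proof (induction m)
    case 0
    then show ?case by (simp add: t_def e_def algebra_simps)
  next
    case (Suc m)
    then show ?case using P_Suc[of m] by (simp add: t_def e_Suc algebra_simps power_add)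
  qed
  \<comment> \<open>The new exponents are the generalized pentagonal numbers of index
    \<open>n + 1\<close>: one from the added summand \<open>s = n + 1\<close>, one from the
    remainder \<open>t n\<close>.\<close>
  have last: "e (Suc n) + Suc n = Suc n * (3 * Suc n + 1) div 2"
    "e n + n + Suc n = Suc n * (3 * Suc n - 1) div 2"
  proof -
    obtain c where c: "n * Suc n = 2 * c" by (metis dvdE even_Suc even_mult_iff)
    have "e n = n * n + c" "Suc n * (3 * Suc n + 1) = 2 * (n * n + c + n + Suc n + Suc n)"
      "Suc n * (3 * Suc n - 1) = 2 * (n * n + c + n + Suc n)"
      using c by (simp_all add: e_def algebra_simps)
    then show "e (Suc n) + Suc n = Suc n * (3 * Suc n + 1) div 2"
      "e n + n + Suc n = Suc n * (3 * Suc n - 1) div 2"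
      by (simp_all only: e_Suc) simp_all
  qed
  have "(\<Sum>s\<le>Suc n. (-1) ^ s * (\<Prod>k=Suc s..Suc n. 1 - q ^ k) * q ^ (s * Suc n + s * Suc s div 2))
      = (\<Sum>s\<le>n. (-1) ^ s * ((1 - q ^ Suc n) * P s) * q ^ (e s + s)) + (-1) ^ Suc n * q ^ (e (Suc n) + Suc n)"
  proof -
    have "s * Suc n + s * Suc s div 2 = e s + s" for s by (simp add: e_def)
    moreover have "(\<Prod>k=Suc s..Suc n. 1 - q ^ k) = (1 - q ^ Suc n) * P s" if "s \<le> n" for s
      using that by (simp add: P_def mult.commute)
    moreover have "(\<Prod>k=Suc (Suc n)..Suc n. 1 - q ^ k) = 1" by simp
    ultimately show ?thesis
      unfolding sum.atMost_Suc
      by (intro arg_cong2[of _ _ _ _ "(+)"] sum.cong refl) (simp_all only: atMost_iff mult_1_right)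
  qed
  also have "(\<Sum>s\<le>n. (-1) ^ s * ((1 - q ^ Suc n) * P s) * q ^ (e s + s)) =
      (\<Sum>s\<le>n. (-1) ^ s * P s * q ^ e s) + (\<Sum>s\<le>n. (-1) ^ s * P s * ((1 - q ^ Suc n) * q ^ (e s + s) - q ^ e s))"
    unfolding sum.distrib[symmetric] by (intro sum.cong) (simp_all add: algebra_simps)
  also have "(\<Sum>s\<le>n. (-1) ^ s * P s * ((1 - q ^ Suc n) * q ^ (e s + s) - q ^ e s)) = - t n"
    by (rule telescope) simp
  also have "t n = (-1) ^ n * q ^ (e n + n + Suc n)" by (simp add: t_def P_def)
  also have "(\<Sum>s\<le>n. (-1) ^ s * P s * q ^ e s) =
     1 + (\<Sum>s=1..n. (-1) ^ s * (q ^ (s * (3 * s + 1) div 2) + q ^ (s * (3 * s - 1) div 2)))"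
    using Suc by (simp only: P_def e_def)
  finally show ?case by (simp only: last) (simp add: algebra_simps)
qed simp

lemma shanks_triangular:
  fixes q :: "'a::comm_ring_1"
  shows "(\<Sum>s\<le>n. (\<Prod>k=Suc s..n. 1 - q ^ (2 * k)) * (\<Prod>k=1..s. 1 - q ^ (2 * k - 1)) * q ^ (s * (2 * n + 1))) =
    (\<Prod>k=1..n. 1 - q ^ (2 * k - 1)) * (\<Sum>j\<le>2 * n. q ^ (j * Suc j div 2))"
proof (induction n)
  case (Suc n)
  define A where "A = (\<lambda>s. (\<Prod>k=Suc s..n. 1 - q ^ (2 * k)) * (\<Prod>k=1..s. 1 - q ^ (2 * k - 1)))"
  define D where "D = (\<Prod>k=1..n. 1 - q ^ (2 * k - 1))"
  define e where "e = (\<lambda>s. s * (2 * n + 1))"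
  define u where "u = 1 - q ^ (2 * n + 1)"
  have A_Suc: "A (Suc s) * (1 - q ^ (2 * Suc s)) = A s * (1 - q ^ (2 * s + 1))" if "s < n" for s
  proof -
    have "(\<Prod>k=Suc s..n. 1 - q ^ (2 * k)) = (1 - q ^ (2 * Suc s)) * (\<Prod>k=Suc (Suc s)..n. 1 - q ^ (2 * k))"
      using that by (subst prod.atLeast_Suc_atMost) auto
    then show ?thesis by (simp add: A_def mult_ac)
  qed
  \<comment> \<open>By \<open>A_Suc\<close> the summand of index \<open>s \<ge> 1\<close> in
    \<open>telescope\<close> is \<open>t s - t (s - 1)\<close>.\<close>
  define t where "t = (\<lambda>s. A s * (1 - q ^ (2 * s + 1)) * q ^ (e s + 2 * n + 1))"
  have telescope: "(\<Sum>s\<le>m. A s * ((1 - q ^ (2 * Suc n)) * q ^ (e s + 2 * s) - u * q ^ e s)) = t m"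
    if "m \<le> n" for m
    using that
  proof (induction m)
    case 0
    then show ?case by (simp add: t_def e_def u_def algebra_simps)
  next
    case (Suc m)
    have "A (Suc m) * ((1 - q ^ (2 * Suc n)) * q ^ (e (Suc m) + 2 * Suc m) - u * q ^ e (Suc m)) =
       t (Suc m) - A (Suc m) * (1 - q ^ (2 * Suc m)) * q ^ e (Suc m)"
      by (simp add: t_def u_def algebra_simps power_add)
    moreover have "A (Suc m) * (1 - q ^ (2 * Suc m)) * q ^ e (Suc m) = t m"
    proof -
      have "e (Suc m) = e m + 2 * n + 1" by (simp add: e_def)
      then show ?thesis using A_Suc[of m] Suc.prems by (simp only: t_def)
    qed
    ultimately show ?case using Suc by simp
  qed
  have A_n: "A n = D" by (simp add: A_def D_def)
  have "(\<Sum>s\<le>Suc n. (\<Prod>k=Suc s..Suc n. 1 - q ^ (2 * k)) * (\<Prod>k=1..s. 1 - q ^ (2 * k - 1)) * q ^ (s * (2 * Suc n + 1)))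
     = (\<Sum>s\<le>n. A s * ((1 - q ^ (2 * Suc n)) * q ^ (e s + 2 * s))) + D * u * q ^ (Suc n * (2 * Suc n + 1))"
  proof -
    have "s * (2 * Suc n + 1) = e s + 2 * s" for s by (simp add: e_def)
    moreover have "(\<Prod>k=Suc s..Suc n. 1 - q ^ (2 * k)) * (\<Prod>k=1..s. 1 - q ^ (2 * k - 1)) * x =
        A s * ((1 - q ^ (2 * Suc n)) * x)" if "s \<le> n" for s x
      using that by (simp add: A_def mult_ac)
    moreover have "(\<Prod>k=Suc (Suc n)..Suc n. 1 - q ^ (2 * k)) * (\<Prod>k=1..Suc n. 1 - q ^ (2 * k - 1)) = D * u"
      by (simp add: D_def u_def)
    ultimately show ?thesis
      unfolding sum.atMost_Suc
      by (intro arg_cong2[of _ _ _ _ "(+)"] sum.cong refl) (simp_all only: atMost_iff)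
  qed
  also have "(\<Sum>s\<le>n. A s * ((1 - q ^ (2 * Suc n)) * q ^ (e s + 2 * s))) =
      u * (\<Sum>s\<le>n. A s * q ^ e s) + (\<Sum>s\<le>n. A s * ((1 - q ^ (2 * Suc n)) * q ^ (e s + 2 * s) - u * q ^ e s))"
    unfolding sum_distrib_left sum.distrib[symmetric] by (intro sum.cong) (simp_all add: algebra_simps)
  also have "(\<Sum>s\<le>n. A s * ((1 - q ^ (2 * Suc n)) * q ^ (e s + 2 * s) - u * q ^ e s)) = t n"
    by (rule telescope) simp
  also have "(\<Sum>s\<le>n. A s * q ^ e s) = D * (\<Sum>j\<le>2 * n. q ^ (j * Suc j div 2))"
    using Suc by (simp only: A_def D_def e_def)
  \<comment> \<open>The remainder \<open>t n\<close> supplies the triangular number of index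
    \<open>2 * n + 1\<close>, the added summand \<open>s = n + 1\<close> the one of index
    \<open>2 * n + 2\<close>.\<close>
  also have "t n = D * u * q ^ (Suc (2 * n) * Suc (Suc (2 * n)) div 2)"
  proof -
    have "Suc (2 * n) * Suc (Suc (2 * n)) = 2 * (e n + 2 * n + 1)" by (simp add: e_def algebra_simps)
    then show ?thesis by (simp only: t_def A_n u_def) simp
  qed
  also have "Suc n * (2 * Suc n + 1) = Suc (Suc (2 * n)) * Suc (Suc (Suc (2 * n))) div 2"
    by (simp add: algebra_simps)
  also have "D * u = (\<Prod>k=1..Suc n. 1 - q ^ (2 * k - 1))" by (simp add: D_def u_def)
  finally show ?case
    by (simp add: D_def u_def algebra_simps)
qed simp

section \<open>Representations by \<open>2x\<^sup>2 + y\<^sup>2\<close>\<close>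

text \<open>Thue's argument: \<open>y / x\<close> gives a square root \<open>r\<close> of -2 modulo
  \<open>p\<close>, and the pigeonhole principle yields a short nonzero vector with \<open>a\<close>
  congruent to \<open>r * b\<close>, whose norm \<open>a\<^sup>2 + 2 * b\<^sup>2\<close> is
  \<open>p\<close> or \<open>2 * p\<close>.\<close>

lemma prime_form_representation:
  fixes p :: nat and x y :: int
  assumes p: "prime p" and dvd: "int p dvd 2 * x\<^sup>2 + y\<^sup>2" and x: "\<not> int p dvd x"
  obtains a b :: int where "a\<^sup>2 + 2 * b\<^sup>2 = int p"
proof -
  have prime: "prime (int p)" using p by simp
  have "coprime x (int p)" using prime x by (metis coprime_commute prime_imp_coprime)
  then obtain v where v: "[x * v = 1] (mod int p)" using cong_solve_coprime_int by blast
  define r where "r = y * v"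
  have r: "int p dvd r\<^sup>2 + 2"
  proof -
    have "int p dvd v\<^sup>2 * (2 * x\<^sup>2 + y\<^sup>2)" using dvd by simp
    moreover have "int p dvd (x * v)\<^sup>2 - 1"
      using cong_pow[OF v, of 2] by (simp add: cong_iff_dvd_diff)
    then have "int p dvd 2 * ((x * v)\<^sup>2 - 1)" by (rule dvd_mult)
    ultimately have "int p dvd v\<^sup>2 * (2 * x\<^sup>2 + y\<^sup>2) - 2 * ((x * v)\<^sup>2 - 1)" by (rule dvd_diff)
    then show ?thesis by (simp add: r_def power_mult_distrib algebra_simps)
  qed
  define s where "s = floor_sqrt p"
  \<comment> \<open>The box \<open>?S\<close> thus has more points than there are residues, while
    coordinate differences still have squares below \<open>p\<close>.\<close>
  have s_le: "s\<^sup>2 \<le> p" and s_gt: "p < (Suc s)\<^sup>2"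
    using floor_sqrt_power2_le Suc_floor_sqrt_power2_gt by (auto simp: s_def)
  have "s\<^sup>2 \<noteq> p" using p by (metis prime_power_iff numeral_One numeral_eq_iff semiring_norm(85))
  with s_le have s_lt: "(int s)\<^sup>2 < int p"
    by (metis le_neq_implies_less of_nat_less_iff of_nat_power)
  define g where "g = (\<lambda>(i, j). (i - r * j) mod int p)"
  let ?S = "{0..int s} \<times> {0..int s}"
  have "card (g ` ?S) \<le> card {0..<int p}"
    using prime_gt_0_nat[OF p] by (intro card_mono) (auto simp: g_def)
  also have "\<dots> < card ?S" using s_gt by (simp add: power2_eq_square nat_add_distrib)
  finally have "\<not> inj_on g ?S" by (rule pigeonhole)
  then obtain i j i' j' where ij: "(i, j) \<in> ?S" "(i', j') \<in> ?S" "(i, j) \<noteq> (i', j')"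
    "g (i, j) = g (i', j')" unfolding inj_on_def by fast
  define a b where "a = i - i'" and "b = j - j'"
  have sq: "a\<^sup>2 < int p" "b\<^sup>2 < int p"
  proof -
    have "\<bar>a\<bar> \<le> \<bar>int s\<bar>" "\<bar>b\<bar> \<le> \<bar>int s\<bar>" using ij by (auto simp: a_def b_def)
    then show "a\<^sup>2 < int p" "b\<^sup>2 < int p" using s_lt by (meson abs_le_square_iff order_le_less_trans)+
  qed
  have nz: "a \<noteq> 0 \<or> b \<noteq> 0" using ij by (auto simp: a_def b_def)
  have "int p dvd (i - r * j) - (i' - r * j')" using ij(4) by (simp add: g_def mod_eq_dvd_iff)
  then have "int p dvd a - r * b" by (simp add: a_def b_def algebra_simps)
  then have "int p dvd (a - r * b) * (a + r * b) + (r\<^sup>2 + 2) * b\<^sup>2" using r by simp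
  then have "int p dvd a\<^sup>2 + 2 * b\<^sup>2" by (simp add: algebra_simps power2_eq_square)
  then obtain c where c: "a\<^sup>2 + 2 * b\<^sup>2 = int p * c" by blast
  have "0 < a\<^sup>2 + 2 * b\<^sup>2" using nz
    by (metis add_nonneg_pos add_pos_nonneg mult_pos_pos zero_less_numeral zero_less_power2
        zero_le_power2 mult_nonneg_nonneg zero_le_numeral)
  then have "c > 0" using c prime_gt_0_nat[OF p] by (simp add: zero_less_mult_iff)
  moreover have "int p * c < int p * 3" using c sq by linarith
  then have "c < 3" using prime_gt_0_nat[OF p] by simp
  ultimately consider "c = 1" | "c = 2" by linarith
  then show thesis
  proof cases
    case 1
    then show thesis using c that by simp
  next
    case 2
    \<comment> \<open>Norm \<open>2 * p\<close>: division by \<surd>-2 swaps the roles of the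
      coordinates and halves the norm.\<close>
    with c have "a\<^sup>2 = 2 * (int p - b\<^sup>2)" by simp
    then have "even (a\<^sup>2)" by simp
    then obtain d where "a = 2 * d" by auto
    with c 2 have "b\<^sup>2 + 2 * d\<^sup>2 = int p" by (simp add: power2_eq_square)
    then show thesis by (rule that)
  qed
qed

text \<open>
  When \<open>M\<close> is not \<open>2\<close> modulo \<open>3\<close>, the condition at \<open>3\<close> in \<open>reps\<close> says the same as \<open>3 \<nmid> y\<close>,
  but it is also invariant under multiplication by elements of \<open>\<int>[\<surd>-2]\<close> of norm prime to \<open>3\<close>.
\<close>

definition reps :: "int \<Rightarrow> (int \<times> int) set" where
  "reps M = {(x, y). 2 * x\<^sup>2 + y\<^sup>2 = M \<and> \<not> (3 dvd x \<and> 3 dvd y)}"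

definition pos_reps :: "nat \<Rightarrow> (nat \<times> nat) set" where
  "pos_reps M = {(x, y). 2 * x\<^sup>2 + y\<^sup>2 = M \<and> \<not> 3 dvd y}"

lemma finite_reps: "finite (reps M)"
proof (rule finite_subset)
  have le: "\<bar>z\<bar> \<le> z\<^sup>2" for z :: int
    using self_le_power[of "\<bar>z\<bar>" 2] by (cases "z = 0") (auto simp: abs_le_iff)
  show "reps M \<subseteq> {-M..M} \<times> {-M..M}"
  proof
    fix z assume "z \<in> reps M"
    then obtain x y where z: "z = (x, y)" "2 * x\<^sup>2 + y\<^sup>2 = M" by (auto simp: reps_def)
    then show "z \<in> {-M..M} \<times> {-M..M}"
      using le[of x] le[of y] zero_le_power2[of x] zero_le_power2[of y] by auto
  qed
qed simp

text \<open>If \<open>3\<close> divides \<open>y\<close> but not \<open>x\<close>, then the form has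
  residue 2 modulo 3.\<close>

lemma not_dvd_3_iff:
  fixes x y :: int
  assumes "(2 * x\<^sup>2 + y\<^sup>2) mod 3 \<noteq> 2"
  shows "3 dvd y \<longleftrightarrow> 3 dvd x \<and> 3 dvd y"
proof -
  have sq: "z\<^sup>2 mod 3 = (if 3 dvd z then 0 else 1)" for z :: int
  proof -
    have "z mod 3 \<in> {0, 1, 2}" by auto
    then have "(z mod 3)\<^sup>2 mod 3 = (if z mod 3 = 0 then 0 else 1)" by auto
    then show ?thesis by (simp add: power_mod dvd_eq_mod_eq_0)
  qed
  show ?thesis using assms sq[of x] sq[of y] by (auto split: if_splits) presburger
qed

text \<open>As \<open>M mod 8 = 3\<close>, \<open>M\<close> is neither a square nor twice a square,
  so no coordinate vanishes and each positive solution has four sign variants. The two conditions at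
  3 agree by \<open>not_dvd_3_iff\<close>.\<close>

lemma card_reps:
  assumes "M mod 8 = 3" and "M mod 3 \<noteq> 2"
  shows "card (reps (int M)) = 4 * card (pos_reps M)"
proof -
  have sq8: "z\<^sup>2 mod 8 \<in> {0, 1, 4}" for z :: nat
  proof -
    have "z mod 8 \<in> {0, 1, 2, 3, 4, 5, 6, 7}" by auto
    then have "(z mod 8)\<^sup>2 mod 8 \<in> {0, 1, 4}" by auto
    then show ?thesis by (simp add: power_mod)
  qed
  have nz: "0 < x \<and> 0 < y" if "2 * x\<^sup>2 + y\<^sup>2 = M" for x y :: nat
  proof (rule ccontr)
    assume "\<not> (0 < x \<and> 0 < y)"
    then have "M = y\<^sup>2 \<or> M = 2 * x\<^sup>2" using that by auto
    moreover have "M \<noteq> y\<^sup>2" using assms(1) sq8[of y] by auto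
    moreover have "odd M" using assms(1) by presburger
    then have "M \<noteq> 2 * x\<^sup>2" by auto
    ultimately show False by blast
  qed
  have mod3: "int M mod 3 \<noteq> 2" using assms(2) by presburger
  let ?f = "\<lambda>((s, t), (x, y)). (s * int x, t * int y)"
  have "bij_betw ?f (({1, -1} \<times> {1, -1}) \<times> pos_reps M) (reps (int M))"
  proof (rule bij_betw_imageI)
    show "inj_on ?f (({1, -1} \<times> {1, -1}) \<times> pos_reps M)"
    proof -
      have aux: "s = s' \<and> x = x'"
        if "s \<in> {1, -1}" "s' \<in> {1, -1}" "0 < x" "0 < x'" "s * int x = s' * int x'" for s s' x x'
        using that by auto
      show ?thesis
      proof (rule inj_onI)
        fix z z' assume z: "z \<in> ({1, -1} \<times> {1, -1}) \<times> pos_reps M" "z' \<in> ({1, -1} \<times> {1, -1}) \<times> pos_reps M"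
          and eq: "?f z = ?f z'"
        obtain s t x y s' t' x' y' where *: "z = ((s, t), (x, y))" "z' = ((s', t'), (x', y'))"
          by (metis surj_pair)
        have "0 < x \<and> 0 < y" "0 < x' \<and> 0 < y'" using z nz[of x y] nz[of x' y'] by (auto simp: * pos_reps_def)
        then show "z = z'" using z eq aux[of s s' x x'] aux[of t t' y y'] by (simp add: *) blast
      qed
    qed
    show "?f ` (({1, -1} \<times> {1, -1}) \<times> pos_reps M) = reps (int M)"
    proof (intro equalityI subsetI)
      fix z assume "z \<in> ?f ` (({1, -1} \<times> {1, -1}) \<times> pos_reps M)"
      then obtain s t x y where *: "z = (s * int x, t * int y)" "s = 1 \<or> s = -1" "t = 1 \<or> t = -1"
        "2 * x\<^sup>2 + y\<^sup>2 = M" "\<not> 3 dvd y" by (auto simp: pos_reps_def)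
      then have "s\<^sup>2 = 1" "t\<^sup>2 = 1" by auto
      then have "2 * (s * int x)\<^sup>2 + (t * int y)\<^sup>2 = int M"
        using *(4) by (auto simp: power_mult_distrib)
      moreover have "\<not> 3 dvd t * int y" using *(3,5) by auto presburger+
      ultimately show "z \<in> reps (int M)" using *(1) by (simp add: reps_def)
    next
      fix z assume "z \<in> reps (int M)"
      then obtain x y where z: "z = (x, y)" "2 * x\<^sup>2 + y\<^sup>2 = int M" "\<not> (3 dvd x \<and> 3 dvd y)"
        by (auto simp: reps_def)
      then have "\<not> 3 dvd y" using not_dvd_3_iff[of x y] mod3 by simp
      then have "\<not> 3 dvd nat \<bar>y\<bar>" by (simp add: dvd_nat_abs_iff)
      moreover have "int (2 * (nat \<bar>x\<bar>)\<^sup>2 + (nat \<bar>y\<bar>)\<^sup>2) = int M" using z by simp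
      then have "2 * (nat \<bar>x\<bar>)\<^sup>2 + (nat \<bar>y\<bar>)\<^sup>2 = M" by (simp only: of_nat_eq_iff)
      ultimately have "(nat \<bar>x\<bar>, nat \<bar>y\<bar>) \<in> pos_reps M" by (simp add: pos_reps_def)
      moreover have "z = ?f ((if x < 0 then -1 else 1, if y < 0 then -1 else 1), (nat \<bar>x\<bar>, nat \<bar>y\<bar>))"
        using z by simp
      ultimately show "z \<in> ?f ` (({1, -1} \<times> {1, -1}) \<times> pos_reps M)"
        by (intro rev_image_eqI[of "((if x < 0 then -1 else 1, if y < 0 then -1 else 1), (nat \<bar>x\<bar>, nat \<bar>y\<bar>))"]) auto
    qed
  qed
  then have "card (reps (int M)) = card ((({1, -1 :: int} \<times> {1, -1 :: int}) \<times> pos_reps M))"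
    by (simp add: bij_betw_same_card)
  also have "\<dots> = 4 * card (pos_reps M)" by (simp add: card_cartesian_product)
  finally show ?thesis .
qed

text \<open>
  A pair \<open>(x, y)\<close> stands for \<open>z = y + x\<surd>-2\<close>. If \<open>\<pi> = a + b\<surd>-2\<close> has norm \<open>p\<close>, then \<open>a * x + b * y\<close> is the
  coefficient of \<open>\<surd>-2\<close> in \<open>\<pi>z\<close>, so \<open>split_reps p a b M\<close> collects the \<open>z\<close> not divisible by the
  conjugate of \<open>\<pi>\<close>. Multiplication by \<open>\<pi>\<close> maps this set for \<open>M\<close> bijectively to the one for \<open>p * M\<close>.
\<close>

definition split_reps :: "int \<Rightarrow> int \<Rightarrow> int \<Rightarrow> int \<Rightarrow> (int \<times> int) set" where
  "split_reps p a b M = {(x, y) \<in> reps M. \<not> p dvd a * x + b * y}"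

text \<open>In the notation above these are the \<open>z\<close> not divisible by \<open>p\<close>
  itself, which makes sense whether or not \<open>p\<close> is a norm.\<close>

definition prim_reps :: "int \<Rightarrow> int \<Rightarrow> (int \<times> int) set" where
  "prim_reps p M = {(x, y) \<in> reps M. \<not> (p dvd x \<and> p dvd y)}"

section \<open>Primes that are norms from \<int>[\<surd>-2]\<close>

locale split_prime =
  fixes p a b :: int
  assumes prime: "prime p" and ge: "p \<ge> 5" and p_eq: "a\<^sup>2 + 2 * b\<^sup>2 = p"
begin

lemma not_dvd_2: "\<not> p dvd 2"
  using ge by (auto dest: zdvd_imp_le)

lemma not_dvd_b: "\<not> p dvd b"
proof
  assume "p dvd b"
  then have "p dvd 2 * b\<^sup>2" "p\<^sup>2 dvd 2 * b\<^sup>2" by (auto simp: power2_eq_square mult_dvd_mono)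
  moreover have "p dvd a\<^sup>2" using calculation p_eq
    by (metis add_diff_cancel_right' dvd_diff dvd_refl)
  then have "p dvd a" using prime prime_dvd_power by blast
  then have "p\<^sup>2 dvd a\<^sup>2" by simp
  ultimately have "p\<^sup>2 dvd p" using p_eq by (metis dvd_add)
  then have "p * p \<le> p * 1" using ge by (auto dest: zdvd_imp_le simp: power2_eq_square)
  then show False using ge by simp
qed

lemma not_dvd_a: "\<not> p dvd a"
proof
  assume "p dvd a"
  then have "p dvd a\<^sup>2" by (simp add: power2_eq_square)
  then have "p dvd 2 * b\<^sup>2" using p_eq by (metis add_diff_cancel_left' dvd_diff dvd_refl)
  then show False
    using prime not_dvd_2 not_dvd_b by (auto simp: prime_dvd_mult_iff dest: prime_dvd_power)
qed

text \<open>The factors are the coefficients of \<surd>-2 in the products of \<open>z\<close> with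
  the conjugate of \<pi> and with \<pi>. Modulo \<open>p\<close> their product is
  \<open>- b\<^sup>2\<close> times the norm of \<open>z\<close>.\<close>

lemma dvd_prod_conj: "p dvd (a * x - b * y) * (a * x + b * y) \<longleftrightarrow> p dvd 2 * x\<^sup>2 + y\<^sup>2"
proof -
  have "(a * x - b * y) * (a * x + b * y) = p * x\<^sup>2 - b\<^sup>2 * (2 * x\<^sup>2 + y\<^sup>2)"
    unfolding p_eq[symmetric] by (simp add: algebra_simps power2_eq_square)
  then have "p dvd (a * x - b * y) * (a * x + b * y) \<longleftrightarrow> p dvd b\<^sup>2 * (2 * x\<^sup>2 + y\<^sup>2)"
    by (metis dvd_diff_right_iff dvd_triv_left)
  then show ?thesis using prime not_dvd_b by (auto simp: prime_dvd_mult_iff dest: prime_dvd_power)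
qed

lemma card_split_reps_mult: "card (split_reps p a b (p * M)) = card (split_reps p a b M)"
proof -
  let ?f = "\<lambda>(x, y). (a * x + b * y, a * y - 2 * b * x)"
  \<comment> \<open>Multiplication by the conjugate of \<pi> undoes \<open>?f\<close> up to the
    factor \<open>p\<close>; this gives injectivity, the condition at 3 and, further down, the
    preimage.\<close>
  have inv: "a * (a * x + b * y) - b * (a * y - 2 * b * x) = p * x"
    "a * (a * y - 2 * b * x) + 2 * b * (a * x + b * y) = p * y" for x y
    unfolding p_eq[symmetric] by (simp_all add: algebra_simps power2_eq_square)
  have norm: "2 * (a * x + b * y)\<^sup>2 + (a * y - 2 * b * x)\<^sup>2 = p * (2 * x\<^sup>2 + y\<^sup>2)" for x y
    unfolding p_eq[symmetric] by (simp add: algebra_simps power2_eq_square)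
  have p0: "p \<noteq> 0" using ge by simp
  have three: "3 dvd p * x \<longleftrightarrow> 3 dvd x" for x
  proof -
    have "\<not> 3 dvd p" using prime ge by (auto simp: prime_int_iff dest: spec[of _ 3])
    then show ?thesis by (simp add: prime_dvd_mult_iff)
  qed
  have "inj_on ?f (split_reps p a b M)"
  proof (rule inj_onI, clarify)
    fix x y x' y' assume "a * x + b * y = a * x' + b * y'" "a * y - 2 * b * x = a * y' - 2 * b * x'"
    then have "p * x = p * x'" "p * y = p * y'" using inv by metis+
    then show "x = x' \<and> y = y'" using p0 by simp
  qed
  moreover have "?f ` split_reps p a b M = split_reps p a b (p * M)"
  proof (intro equalityI subsetI)
    fix z assume "z \<in> ?f ` split_reps p a b M"
    then obtain x y where z: "z = ?f (x, y)" and M: "2 * x\<^sup>2 + y\<^sup>2 = M"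
      and not3: "\<not> (3 dvd x \<and> 3 dvd y)" and nd: "\<not> p dvd a * x + b * y"
      by (auto simp: split_reps_def reps_def)
    have "\<not> (3 dvd a * x + b * y \<and> 3 dvd a * y - 2 * b * x)"
    proof
      assume "3 dvd a * x + b * y \<and> 3 dvd a * y - 2 * b * x"
      then have "3 dvd a * (a * x + b * y) - b * (a * y - 2 * b * x)"
        "3 dvd a * (a * y - 2 * b * x) + 2 * b * (a * x + b * y)"
        by (simp_all only: dvd_add dvd_diff dvd_mult)
      then show False using not3 three unfolding inv by blast
    qed
    moreover have "\<not> p dvd a * (a * x + b * y) + b * (a * y - 2 * b * x)"
    proof
      assume "p dvd a * (a * x + b * y) + b * (a * y - 2 * b * x)"
      \<comment> \<open>This is \<open>\<pi>\<^sup>2 = 2 * a * \<pi> - p\<close> applied to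
        \<open>z\<close> and read off at \<surd>-2.\<close>
      moreover have "a * (a * x + b * y) + b * (a * y - 2 * b * x) = 2 * a * (a * x + b * y) - p * x"
        unfolding p_eq[symmetric] by (simp add: algebra_simps power2_eq_square)
      ultimately have "p dvd 2 * a * (a * x + b * y)" by (metis dvd_diff_left_iff dvd_triv_left)
      then show False using prime nd not_dvd_2 not_dvd_a by (auto simp: prime_dvd_mult_iff)
    qed
    ultimately show "z \<in> split_reps p a b (p * M)"
      using z M norm[of x y] by (simp add: split_reps_def reps_def)
  next
    fix z assume "z \<in> split_reps p a b (p * M)"
    then obtain X Y where z: "z = (X, Y)" and M: "2 * X\<^sup>2 + Y\<^sup>2 = p * M"
      and 3: "\<not> (3 dvd X \<and> 3 dvd Y)" and nd: "\<not> p dvd a * X + b * Y"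
      by (auto simp: split_reps_def reps_def)
    \<comment> \<open>The norm is divisible by \<open>p\<close> but the conjugate of \<pi> does not
      divide this element, so \<pi> does; \<open>x\<close> and \<open>y\<close> below are the
      coordinates of the quotient.\<close>
    have "p dvd (a * X - b * Y) * (a * X + b * Y)" using M by (simp add: dvd_prod_conj)
    then have d: "p dvd a * X - b * Y" using prime nd by (simp add: prime_dvd_mult_iff)
    then obtain x where x: "a * X - b * Y = p * x" by blast
    have "p dvd p * X - a * (a * X - b * Y)" using d by simp
    also have "p * X - a * (a * X - b * Y) = b * (a * Y + 2 * b * X)"
      unfolding p_eq[symmetric] by (simp add: algebra_simps power2_eq_square)
    finally have "p dvd a * Y + 2 * b * X" using prime not_dvd_b by (simp add: prime_dvd_mult_iff)
    then obtain y where y: "a * Y + 2 * b * X = p * y" by blast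
    have "p * (a * x + b * y) = a * (a * X - b * Y) + b * (a * Y + 2 * b * X)"
      using x y by (simp add: algebra_simps)
    also have "\<dots> = p * X" unfolding p_eq[symmetric] by (simp add: algebra_simps power2_eq_square)
    finally have X: "X = a * x + b * y" using p0 by simp
    have "p * (a * y - 2 * b * x) = a * (a * Y + 2 * b * X) - 2 * b * (a * X - b * Y)"
      using x y by (simp add: algebra_simps)
    also have "\<dots> = p * Y" unfolding p_eq[symmetric] by (simp add: algebra_simps power2_eq_square)
    finally have Y: "Y = a * y - 2 * b * x" using p0 by simp
    have "2 * x\<^sup>2 + y\<^sup>2 = M" using M norm[of x y] X Y p0 by simp
    moreover have "\<not> (3 dvd x \<and> 3 dvd y)" using 3 X Y by auto
    moreover have "\<not> p dvd a * x + b * y"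
    proof
      assume "p dvd a * x + b * y"
      then have pX: "p dvd X" using X by simp
      have "p dvd a * X - (a * X - b * Y)" by (rule dvd_diff[OF dvd_mult[OF pX] d])
      then have "p dvd b * Y" by simp
      then have "p dvd a * X + b * Y" using pX by simp
      then show False using nd by contradiction
    qed
    ultimately have "(x, y) \<in> split_reps p a b M" by (simp add: split_reps_def reps_def)
    then show "z \<in> ?f ` split_reps p a b M" using z X Y by force
  qed
  ultimately show ?thesis using card_image[of ?f "split_reps p a b M"] by simp
qed

text \<open>As \<open>p\<close> divides the norm, each \<open>z\<close> is divisible by \<pi> or its
  conjugate, and by both only if \<open>p\<close> divides \<open>z\<close>. The primitive
  \<open>z\<close> thus fall into two disjoint classes, interchanged by the conjugation
  \<open>?c\<close>.\<close>

lemma card_prim_reps: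
  assumes "p dvd M"
  shows "card (prim_reps p M) = 2 * card (split_reps p a b M)"
proof -
  let ?A = "split_reps p a b M" and ?c = "\<lambda>(x, y). (- x, y :: int)"
  have inj: "inj_on ?c ?A" by (auto simp: inj_on_def)
  have both: "\<not> (p dvd a * x - b * y \<and> p dvd a * x + b * y)" if "\<not> (p dvd x \<and> p dvd y)" for x y
  proof
    assume *: "p dvd a * x - b * y \<and> p dvd a * x + b * y"
    then have "p dvd (a * x - b * y) + (a * x + b * y)" "p dvd (a * x + b * y) - (a * x - b * y)"
      using dvd_add dvd_diff by blast+
    then have "p dvd 2 * a * x" "p dvd 2 * b * y" by (simp_all add: algebra_simps)
    then show False
      using that prime not_dvd_2 not_dvd_a not_dvd_b by (simp add: prime_dvd_mult_iff)
  qed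
  have one: "p dvd a * x - b * y \<or> p dvd a * x + b * y" if "(x, y) \<in> reps M" for x y
    using that assms dvd_prod_conj[of x y] prime by (simp add: reps_def prime_dvd_mult_iff)
  have conj: "(- x, y) \<in> reps M \<longleftrightarrow> (x, y) \<in> reps M" for x y by (simp add: reps_def)
  have swap: "(x, y) \<in> ?c ` ?A \<longleftrightarrow> (- x, y) \<in> ?A" for x y by force
  have neg: "p dvd b * y - a * x \<longleftrightarrow> p dvd a * x - b * y" for x y by (metis dvd_minus_iff minus_diff_eq)
  have sub: "\<not> (p dvd x \<and> p dvd y)" if "\<not> p dvd a * x + b * y \<or> \<not> p dvd a * x - b * y" for x y
    using that by auto
  have mem: "(x, y) \<in> ?A \<longleftrightarrow> (x, y) \<in> reps M \<and> \<not> p dvd a * x + b * y"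
    "(x, y) \<in> ?c ` ?A \<longleftrightarrow> (x, y) \<in> reps M \<and> \<not> p dvd a * x - b * y" for x y
    unfolding swap using conj neg[of y x] by (simp_all add: split_reps_def)
  have "z \<in> prim_reps p M \<longleftrightarrow> z \<in> ?A \<union> ?c ` ?A" for z
  proof -
    obtain x y where z: "z = (x, y)" by (cases z)
    show ?thesis
      unfolding z Un_iff mem prim_reps_def mem_Collect_eq prod.case using both[of x y] sub[of x y]
      by blast
  qed
  then have "prim_reps p M = ?A \<union> ?c ` ?A" by blast
  moreover have "z \<notin> ?A \<inter> ?c ` ?A" for z
  proof -
    obtain x y where z: "z = (x, y)" by (cases z)
    show ?thesis unfolding z Int_iff mem using one[of x y] by blast
  qed
  then have "?A \<inter> ?c ` ?A = {}" by blast
  moreover have "finite ?A" using finite_reps[of M] by (rule finite_subset[rotated]) (auto simp: split_reps_def)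
  ultimately show ?thesis by (simp add: card_Un_disjoint card_image[OF inj])
qed

lemma split_reps_eq_reps:
  assumes "\<not> p dvd M"
  shows "split_reps p a b M = reps M"
  using assms dvd_prod_conj by (force simp: split_reps_def reps_def)

end

text \<open>The solutions divisible by \<open>p\<close> are \<open>p\<close> times the solutions for
  \<open>M\<close>; the condition at 3 is unaffected because \<open>p \<ge> 5\<close>.\<close>

lemma reps_mult_square:
  fixes p :: nat
  assumes p: "prime p" "p \<ge> 5"
  shows "card (reps (int p ^ 2 * M)) = card (prim_reps (int p) (int p ^ 2 * M)) + card (reps M)"
proof -
  let ?p = "int p" and ?f = "\<lambda>(x, y). (int p * x, int p * y)"
  have p0: "?p \<noteq> 0" using p by simp
  have three: "3 dvd ?p * x \<longleftrightarrow> 3 dvd x" for x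
  proof -
    have "\<not> 3 dvd p" using p by (auto simp: prime_nat_iff dest: spec[of _ 3])
    then have "\<not> 3 dvd ?p" by (metis int_dvd_int_iff of_nat_numeral)
    then show ?thesis by (simp add: prime_dvd_mult_iff)
  qed
  have "reps (?p ^ 2 * M) = prim_reps ?p (?p ^ 2 * M) \<union> ?f ` reps M"
  proof (intro equalityI subsetI)
    fix z assume z: "z \<in> reps (?p ^ 2 * M)"
    show "z \<in> prim_reps ?p (?p ^ 2 * M) \<union> ?f ` reps M"
    proof (cases "z \<in> prim_reps ?p (?p ^ 2 * M)")
      case False
      then obtain x y where xy: "z = (?p * x, ?p * y)"
        using z by (auto simp: prim_reps_def elim!: dvdE)
      have "?p ^ 2 * (2 * x\<^sup>2 + y\<^sup>2) = ?p ^ 2 * M"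
        using z unfolding xy by (simp add: reps_def power_mult_distrib algebra_simps)
      then have "(x, y) \<in> reps M" using z p0 by (simp add: xy reps_def three)
      then show ?thesis using xy by force
    qed simp
  next
    fix z assume "z \<in> prim_reps ?p (?p ^ 2 * M) \<union> ?f ` reps M"
    then show "z \<in> reps (?p ^ 2 * M)"
      by (auto simp: prim_reps_def reps_def three power_mult_distrib distrib_left mult.left_commute)
  qed
  moreover have "prim_reps ?p (?p ^ 2 * M) \<inter> ?f ` reps M = {}"
    by (auto simp: prim_reps_def)
  moreover have "finite (prim_reps ?p (?p ^ 2 * M))"
    using finite_reps by (rule finite_subset[rotated]) (auto simp: prim_reps_def)
  moreover have "inj_on ?f (reps M)" using p0 by (auto simp: inj_on_def)
  ultimately show ?thesis
    using finite_reps by (simp add: card_Un_disjoint card_image)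
qed

text \<open>A primitive solution has \<open>x\<close> prime to \<open>p\<close>, since otherwise
  \<open>p\<close> would divide \<open>y\<close> too; so \<open>prime_form_representation\<close>
  makes \<open>p\<close> a norm.\<close>

lemma split_prime_or_prim_reps_empty:
  fixes p :: nat
  assumes p: "prime p" "p \<ge> 5" and dvd: "int p dvd M"
  shows "(\<exists>a b. split_prime (int p) a b) \<or> prim_reps (int p) M = {}"
proof (rule disjCI)
  assume "prim_reps (int p) M \<noteq> {}"
  then obtain x y where M: "2 * x\<^sup>2 + y\<^sup>2 = M" and xy: "\<not> (int p dvd x \<and> int p dvd y)"
    by (auto simp: prim_reps_def reps_def)
  have "\<not> int p dvd x"
  proof
    assume x: "int p dvd x"
    then have "int p dvd 2 * x\<^sup>2" by (simp add: power2_eq_square)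
    then have "int p dvd y\<^sup>2" using M dvd by (metis dvd_add_right_iff)
    then have "int p dvd y" using p prime_dvd_power[of "int p"] by simp
    with x xy show False by simp
  qed
  then obtain a b :: int where "a\<^sup>2 + 2 * b\<^sup>2 = int p"
    using prime_form_representation[OF p(1), of x y] dvd M by metis
  then show "\<exists>a b. split_prime (int p) a b" using p by (auto intro!: exI simp: split_prime_def)
qed

text \<open>If \<open>p\<close> is a norm, both sides are twice the same \<open>split_reps\<close>
  count; otherwise both sets are empty.\<close>

lemma card_prim_reps_mult:
  fixes p :: nat
  assumes p: "prime p" "p \<ge> 5" and dvd: "int p dvd M"
  shows "card (prim_reps (int p) (int p * M)) = card (prim_reps (int p) M)"
proof (cases "\<exists>a b. split_prime (int p) a b")
  case True
  then obtain a b where "split_prime (int p) a b" by blast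
  then interpret split_prime "int p" a b .
  show ?thesis using dvd by (simp add: card_prim_reps card_split_reps_mult)
next
  case False
  then show ?thesis using split_prime_or_prim_reps_empty[OF p] dvd by (metis card.empty dvd_triv_left)
qed

text \<open>Solutions are sorted by the exact power of \<open>p\<close> dividing them:
  \<open>j + 1\<close> exponents are possible, and by \<open>card_prim_reps_mult\<close> each class
  is as large as that of the primitive solutions for \<open>p * m\<close>.\<close>

lemma card_reps_odd_power:
  fixes p :: nat
  assumes p: "prime p" "p \<ge> 5" and nd: "\<not> int p dvd m"
  shows "card (reps (int p ^ (2 * j + 1) * m)) = (j + 1) * card (prim_reps (int p) (int p * m))"
proof (induction j)
  case 0
  have "(x, y) \<in> prim_reps (int p) (int p * m)" if "(x, y) \<in> reps (int p * m)" for x y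
  proof -
    have "\<not> (int p dvd x \<and> int p dvd y)"
    proof
      assume "int p dvd x \<and> int p dvd y"
      then have "int p * int p dvd x * x" "int p * int p dvd y * y" by (simp_all add: mult_dvd_mono)
      then have "int p * int p dvd 2 * x\<^sup>2 + y\<^sup>2" by (simp add: power2_eq_square)
      then have "int p * int p dvd int p * m" using that by (simp add: reps_def)
      then show False using nd p by simp
    qed
    then show ?thesis using that by (simp add: prim_reps_def)
  qed
  then have "reps (int p * m) = prim_reps (int p) (int p * m)" by (auto simp: prim_reps_def)
  then show ?case by simp
next
  case (Suc j)
  have prim: "card (prim_reps (int p) (int p ^ Suc i * m)) = card (prim_reps (int p) (int p * m))" for i
  proof (induction i)
    case (Suc i)
    then show ?case using card_prim_reps_mult[OF p, of "int p ^ Suc i * m"] by (simp add: mult.assoc)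
  qed simp
  have eqs: "int p ^ (2 * Suc j + 1) * m = int p ^ 2 * (int p ^ (2 * j + 1) * m)"
    "int p ^ Suc (2 * j + 2) * m = int p ^ 2 * (int p ^ (2 * j + 1) * m)"
    by (simp_all add: power_add power2_eq_square)
  have "card (reps (int p ^ (2 * Suc j + 1) * m)) =
      card (prim_reps (int p) (int p ^ Suc (2 * j + 2) * m)) + card (reps (int p ^ (2 * j + 1) * m))"
    unfolding eqs by (rule reps_mult_square[OF p])
  then show ?case using Suc by (simp only: prim) simp
qed

section \<open>Parity of the number of positive solutions\<close>

lemma odd_square_mod_8: "odd n \<Longrightarrow> n\<^sup>2 mod 8 = 1" for n :: nat
proof -
  assume "odd n"
  then have "n mod 8 \<in> {1, 3, 5, 7}" by (auto; presburger)
  then have "(n mod 8)\<^sup>2 mod 8 = 1" by auto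
  then show ?thesis by (simp add: power_mod)
qed

lemma square_mod_3: "\<not> 3 dvd n \<Longrightarrow> n\<^sup>2 mod 3 = 1" for n :: nat
proof -
  assume "\<not> 3 dvd n"
  then have "n mod 3 \<in> {1, 2}" by (auto; presburger)
  then have "(n mod 3)\<^sup>2 mod 3 = 1" by auto
  then show ?thesis by (simp add: power_mod)
qed

text \<open>This covers the residue excluded in \<open>card_reps\<close>: if \<open>3\<close> does
  not divide \<open>y\<close>, the form is 0 or 1 modulo 3.\<close>

lemma pos_reps_mod_3_eq_2:
  assumes "M mod 3 = 2"
  shows "pos_reps M = {}"
proof -
  have "(2 * x\<^sup>2 + y\<^sup>2) mod 3 \<noteq> 2" if "\<not> 3 dvd y" for x y :: nat
  proof (cases "3 dvd x")
    case True
    then have "3 dvd 2 * x\<^sup>2" by (simp add: power2_eq_square)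
    then show ?thesis using square_mod_3[OF that] by presburger
  next
    case False
    then show ?thesis using square_mod_3[OF that] square_mod_3[OF False] by presburger
  qed
  then show ?thesis using assms by (auto simp: pos_reps_def)
qed

text \<open>The exponent is \<open>2 * j + 1\<close> with \<open>j = 2 * k + 1\<close>, so
  \<open>card_reps_odd_power\<close> gives the even factor \<open>2 * k + 2\<close> relative to the
  count for \<open>p * m\<close>.\<close>

lemma even_card_pos_reps:
  assumes p: "prime p" "p \<ge> 5" and nd: "\<not> p dvd m" and mod8: "p ^ (4 * k + 3) * m mod 8 = 3"
  shows "even (card (pos_reps (p ^ (4 * k + 3) * m)))"
proof (cases "p ^ (4 * k + 3) * m mod 3 = 2")
  case True
  then show ?thesis by (simp add: pos_reps_mod_3_eq_2)
next
  case False
  have "odd p" "\<not> 3 dvd p" using p by (auto simp: prime_nat_iff dest: spec[of _ 2] spec[of _ 3])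
  define q where "q = p ^ (2 * k + 1)"
  have "odd q" "\<not> 3 dvd q" 
    using \<open>odd p\<close> \<open>\<not> 3 dvd p\<close> prime_dvd_power[of 3 p "2 * k + 1"] by (auto simp: q_def)
  then have q: "q\<^sup>2 mod 8 = 1" "q\<^sup>2 mod 3 = 1" by (auto simp: odd_square_mod_8 square_mod_3)
  have "4 * k + 3 = (2 * k + 1) * 2 + 1" by simp
  then have "p ^ (4 * k + 3) = q\<^sup>2 * p" by (simp only: q_def power_add power_mult power_one_right)
  then have eq: "p ^ (4 * k + 3) * m = q\<^sup>2 * (p * m)" by simp
  \<comment> \<open>As \<open>q\<^sup>2\<close> is 1 modulo 8 and 3, these residues are those of the
    full product, and \<open>card_reps\<close> divides both counts by 4.\<close>
  have pm: "p * m mod 8 = 3" "p * m mod 3 \<noteq> 2"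
    using mod8 False mod_mult_left_eq[of "q\<^sup>2" 8 "p * m"] mod_mult_left_eq[of "q\<^sup>2" 3 "p * m"]
    unfolding eq q by simp_all
  have nd': "\<not> int p dvd int m" using nd by simp
  have "4 * card (pos_reps (p ^ (4 * k + 3) * m)) = card (reps (int (p ^ (4 * k + 3) * m)))"
    using card_reps[OF mod8 False] by simp
  also have "int (p ^ (4 * k + 3) * m) = int p ^ (2 * (2 * k + 1) + 1) * int m"
    by (simp add: power_add algebra_simps numeral_3_eq_3)
  also have "card (reps \<dots>) = (2 * k + 2) * card (reps (int (p * m)))"
    using card_reps_odd_power[OF p nd', of "2 * k + 1"] card_reps_odd_power[OF p nd', of 0] by simp
  also have "\<dots> = 4 * (2 * ((k + 1) * card (pos_reps (p * m))))"
    using card_reps[OF pm] by simp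
  finally have "card (pos_reps (p ^ (4 * k + 3) * m)) = 2 * ((k + 1) * card (pos_reps (p * m)))"
    by (metis mult_left_cancel zero_neq_numeral)
  then show ?thesis by simp
qed

text \<open>The four solutions for 3 contribute 4. The primitive ones for
  \<open>3 * p\<^sup>2\<close> number 8 or 0, according to whether \<open>p\<close> is a norm, and a
  quarter of the total is 3 or 1.\<close>

lemma odd_card_pos_reps:
  assumes p: "prime p" "p \<ge> 5"
  shows "odd (card (pos_reps (3 * p\<^sup>2)))"
proof -
  have op: "odd p" using p by (auto simp: prime_nat_iff dest: spec[of _ 2])
  have nd: "\<not> int p dvd 3" using p by (auto dest: zdvd_imp_le)
  have r: "card (reps (int (3 * p\<^sup>2))) = card (prim_reps (int p) (int p ^ 2 * 3)) + card (reps 3)"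
    using reps_mult_square[OF p, of 3] by (simp add: mult.commute)
  have "pos_reps 3 = {(1, 1)}"
  proof -
    have "x = 1 \<and> y = 1" if "2 * x\<^sup>2 + y\<^sup>2 = 3" for x y :: nat
    proof -
      have "x \<le> 1" using that power_mono[of 2 x 2] by (cases "x \<ge> 2") auto
      then have "x = 0 \<or> x = 1" by linarith
      moreover have "y \<le> 1" using that power_mono[of 2 y 2] by (cases "y \<ge> 2") auto
      then have "y = 0 \<or> y = 1" by linarith
      ultimately show ?thesis using that by auto
    qed
    then show ?thesis by (auto simp: pos_reps_def)
  qed
  then have 3: "card (reps 3) = 4" using card_reps[of 3] by simp
  have "card (prim_reps (int p) (int p ^ 2 * 3)) = card (prim_reps (int p) (int p * 3))"
    using card_prim_reps_mult[OF p, of "int p * 3"] by (simp add: power2_eq_square mult.assoc)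
  also have "\<dots> = 8 \<or> \<dots> = 0"
  proof (cases "\<exists>a b. split_prime (int p) a b")
    case True
    then obtain a b where "split_prime (int p) a b" by blast
    then interpret split_prime "int p" a b .
    show ?thesis by (simp add: card_prim_reps card_split_reps_mult split_reps_eq_reps[OF nd] 3)
  next
    case False
    then show ?thesis using split_prime_or_prim_reps_empty[OF p, of "int p * 3"] by auto
  qed
  finally have "card (reps (int (3 * p\<^sup>2))) = 12 \<or> card (reps (int (3 * p\<^sup>2))) = 4"
    using r 3 by auto
  moreover have "3 * p\<^sup>2 mod 8 = 3"
    using odd_square_mod_8[OF op] mod_mult_right_eq[of 3 "p\<^sup>2" 8] by simp
  then have "card (reps (int (3 * p\<^sup>2))) = 4 * card (pos_reps (3 * p\<^sup>2))" by (rule card_reps) simp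
  ultimately have "card (pos_reps (3 * p\<^sup>2)) = 3 \<or> card (pos_reps (3 * p\<^sup>2)) = 1" by linarith
  then show ?thesis by auto
qed

section \<open>Reduction modulo 2\<close>

definition fps_of_int_fps :: "int fps \<Rightarrow> 'a::comm_ring_1 fps" where
  "fps_of_int_fps f = Abs_fps (\<lambda>n. of_int (fps_nth f n))"

lemma fps_of_int_fps_nth [simp]: "fps_nth (fps_of_int_fps f) n = of_int (fps_nth f n)"
  by (simp add: fps_of_int_fps_def)

lemma fps_of_int_fps_1 [simp]: "fps_of_int_fps 1 = 1"
  by (simp add: fps_eq_iff)

lemma fps_of_int_fps_mult: "fps_of_int_fps (f * g) = fps_of_int_fps f * fps_of_int_fps g"
  by (simp add: fps_eq_iff fps_mult_nth)

lemma fps_of_int_fps_power: "fps_of_int_fps (f ^ k) = fps_of_int_fps f ^ k"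
  by (induction k) (simp_all add: fps_of_int_fps_mult)

lemma fps_of_int_fps_euler_prod: "fps_of_int_fps (euler_prod t m) = (euler_prod t m :: 'a::comm_ring_1 fps)"
proof -
  have "fps_of_int_fps (1 - fps_X ^ k) = (1 - fps_X ^ k :: 'a fps)" for k
    by (simp add: fps_eq_iff fps_X_power_nth)
  then show ?thesis
    unfolding euler_prod_def by (induction m) (simp_all add: fps_of_int_fps_mult)
qed

text \<open>Over the field \<open>bit\<close> congruences modulo 2 become equations, and nonzero
  series can be cancelled.\<close>

definition euler_mod2 :: "nat \<Rightarrow> bit fps" where
  "euler_mod2 t = fps_of_int_fps (euler_fps t)"

lemma euler_mod2_agree: "n < t * Suc m \<Longrightarrow> fps_agree n (euler_mod2 t) (euler_prod t m)"
proof -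
  assume "n < t * Suc m"
  then have "fps_agree n (euler_mod2 t) (fps_of_int_fps (euler_prod t m))"
    using euler_fps_agree[of n t m] by (simp add: fps_agree_def euler_mod2_def)
  then show ?thesis by (simp only: fps_of_int_fps_euler_prod)
qed

lemma euler_mod2_nth_0: "t > 0 \<Longrightarrow> fps_nth (euler_mod2 t) 0 = 1"
  using euler_mod2_agree[of 0 t 0] by (simp add: fps_agree_def euler_prod_def)

lemma two_bit_fps: "(2 :: bit fps) = 0"
  by (simp add: numeral_fps_const)

text \<open>In characteristic 2 squaring turns each factor \<open>1 - x\<close> into
  \<open>1 - x\<^sup>2\<close>.\<close>

lemma euler_mod2_double:
  assumes "t > 0"
  shows "euler_mod2 (2 * t) = euler_mod2 t ^ 2"
proof (rule fps_agree_all)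
  fix n
  have lt: "n < t * Suc n" "n < 2 * t * Suc n" using assms by (cases t; simp)+
  have "(1 - x)\<^sup>2 = 1 - x\<^sup>2" for x :: "bit fps"
  proof -
    have "(1 - x)\<^sup>2 = 1 - x\<^sup>2 + 2 * (x\<^sup>2 - x)" by (simp add: power2_eq_square algebra_simps)
    then show ?thesis by (simp add: two_bit_fps)
  qed
  then have "euler_prod (2 * t) n = (euler_prod t n :: bit fps) ^ 2"
    by (simp add: euler_prod_def prod_power_distrib mult_ac flip: power_mult)
  then show "fps_agree n (euler_mod2 (2 * t)) (euler_mod2 t ^ 2)"
    using euler_mod2_agree[OF lt(2)] fps_agree_power[OF euler_mod2_agree[OF lt(1)], of 2]
    by (metis fps_agree_sym fps_agree_trans)
qed

text \<open>Up to degree \<open>n\<close>, the Euler factors with index prime to division by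
  \<open>u\<close> are cancelled by the partition series; those whose index is a multiple of
  \<open>u\<close> form the Euler product in \<open>q ^ u\<close>.\<close>

lemma regular_gf_mod2:
  assumes "u > 0"
  shows "parts_gf {x. 0 < x \<and> \<not> u dvd x} * euler_mod2 1 = euler_mod2 u"
proof (rule fps_agree_all)
  fix n
  let ?A = "{x. 0 < x \<and> x \<le> n \<and> \<not> u dvd x}" and ?q = "\<lambda>x. 1 - fps_X ^ x :: bit fps"
  have dec: "{1..n} = ?A \<union> (\<lambda>j. u * j) ` {1..n div u}"
  proof (intro equalityI subsetI)
    fix x assume x: "x \<in> {1..n}"
    show "x \<in> ?A \<union> (\<lambda>j. u * j) ` {1..n div u}"
    proof (cases "u dvd x")
      case True
      then obtain j where "x = u * j" by blast
      then show ?thesis using x assms by (auto simp: less_eq_div_iff_mult_less_eq mult.commute)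
    qed (use x in auto)
  qed (use assms in \<open>auto simp: less_eq_div_iff_mult_less_eq mult.commute\<close>)
  have "prod ?q {1..n} = prod ?q ?A * prod ?q ((\<lambda>j. u * j) ` {1..n div u})"
    unfolding dec by (rule prod.union_disjoint) auto
  also have "prod ?q ((\<lambda>j. u * j) ` {1..n div u}) = euler_prod u (n div u)"
    using assms by (simp add: euler_prod_def prod.reindex inj_on_def)
  finally have "parts_gf ?A * euler_prod 1 n = (parts_gf ?A * prod ?q ?A) * euler_prod u (n div u)"
    by (simp add: euler_prod_def mult.assoc)
  also have "parts_gf ?A * prod ?q ?A = 1" by (rule parts_gf_prod) auto
  finally have eq: "parts_gf ?A * euler_prod 1 n = (euler_prod u (n div u) :: bit fps)" by simp
  have "fps_agree n (parts_gf {x. 0 < x \<and> \<not> u dvd x} * euler_mod2 1) (parts_gf ?A * euler_prod 1 n)"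
    by (intro fps_agree_mult regular_gf_agree euler_mod2_agree) simp
  also have "parts_gf ?A * euler_prod 1 n = (euler_prod u (n div u) :: bit fps)" by (rule eq)
  also have "fps_agree n (euler_prod u (n div u)) (euler_mod2 u)"
    using assms by (intro fps_agree_sym[OF euler_mod2_agree]) (simp add: dividend_less_times_div)
  finally show "fps_agree n (parts_gf {x. 0 < x \<and> \<not> u dvd x} * euler_mod2 1) (euler_mod2 u)" .
qed

text \<open>Multiplication by \<open>euler_mod2 1 ^ 2\<close> turns both sides into
  \<open>euler_mod2 8 * euler_mod2 3\<close>, by three doublings on the right; the factor is nonzero
  and cancels.\<close>

lemma bipart_gf_mod2:
  "parts_gf {x. 0 < x \<and> \<not> 8 dvd x} * parts_gf {x. 0 < x \<and> \<not> 3 dvd x} = euler_mod2 1 ^ 6 * euler_mod2 3"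
proof -
  let ?B = "parts_gf {x. 0 < x \<and> \<not> 8 dvd x} * parts_gf {x. 0 < x \<and> \<not> 3 dvd x} :: bit fps"
  have "euler_mod2 8 = euler_mod2 1 ^ 8"
    using euler_mod2_double[of 1] euler_mod2_double[of 2] euler_mod2_double[of 4]
    by (simp flip: power_mult)
  moreover have "euler_mod2 1 ^ 2 * ?B = euler_mod2 8 * euler_mod2 3"
    using regular_gf_mod2[of 8] regular_gf_mod2[of 3]
    by (simp add: power2_eq_square mult_ac) (simp flip: mult.assoc)
  ultimately have "euler_mod2 1 ^ 2 * ?B = euler_mod2 1 ^ 2 * (euler_mod2 1 ^ 6 * euler_mod2 3)"
    by (simp add: mult.assoc[symmetric] flip: power_add)
  moreover have "euler_mod2 1 ^ 2 \<noteq> 0" using euler_mod2_nth_0[of 1] by auto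
  ultimately show ?thesis using mult_left_cancel by blast
qed

text \<open>The triangular identity with \<open>q = fps_X ^ 2\<close>, multiplied by
  \<open>?P 0\<close>, reads \<open>E 2 * ?S = E 4 * E 4\<close> up to degree \<open>n\<close>.
  Modulo 2 the right side is \<open>E 2 ^ 4\<close>, and dividing by \<open>E 2\<close> leaves
  \<open>E 2 ^ 3 = E 1 ^ 6\<close>.\<close>

lemma triangular_mod2: "fps_agree n (euler_mod2 1 ^ 6) (\<Sum>j\<le>2 * n. fps_X ^ (j * Suc j))"
proof -
  define q :: "bit fps" where "q = fps_X ^ 2"
  let ?S = "\<Sum>j\<le>2 * n. q ^ (j * Suc j div 2)"
  let ?P = "\<lambda>s. \<Prod>k=Suc s..n. 1 - q ^ (2 * k)" and ?D = "\<lambda>s. \<Prod>k=1..s. 1 - q ^ (2 * k - 1)"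
  have P0: "?P 0 = euler_prod 4 n"
    by (simp add: euler_prod_def q_def flip: power_mult)
  have PD: "?P 0 * ?D n = euler_prod 2 (2 * n)"
  proof -
    have "(\<Prod>k=1..m. 1 - q ^ (2 * k)) * ?D m = (\<Prod>k=1..2 * m. 1 - q ^ k)" for m
      by (induction m) (simp_all add: mult_ac)
    from this[of n] show ?thesis by (simp add: euler_prod_def q_def flip: power_mult)
  qed
  \<comment> \<open>For \<open>s > 0\<close> the power of \<open>q\<close> starts beyond degree
    \<open>n\<close>, so only the summand \<open>s = 0\<close> survives.\<close>
  have "fps_agree n (?P s * ?D s * q ^ (s * (2 * n + 1))) (if s = 0 then ?P 0 else 0)" for s
  proof (cases "s = 0")
    case False
    then have "n < 2 * (s * (2 * n + 1))" by (cases s) auto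
    then show ?thesis using False fps_agree_mult_X_power unfolding q_def power_mult[symmetric] by simp
  qed simp
  then have "fps_agree n (\<Sum>s\<le>n. ?P s * ?D s * q ^ (s * (2 * n + 1))) (\<Sum>s\<le>n. if s = 0 then ?P 0 else 0)"
    by (rule fps_agree_sum)
  then have "fps_agree n (?D n * ?S) (euler_prod 4 n)"
    unfolding shanks_triangular by (simp add: P0)
  then have "fps_agree n (?P 0 * (?D n * ?S)) (?P 0 * euler_prod 4 n)"
    by (intro fps_agree_mult) simp_all
  then have *: "fps_agree n (euler_prod 2 (2 * n) * ?S) (euler_prod 4 n * euler_prod 4 n)"
    by (simp add: P0 PD[symmetric] mult.assoc)
  have "fps_agree n (euler_mod2 2 * ?S) (euler_prod 2 (2 * n) * ?S)"
    by (intro fps_agree_mult euler_mod2_agree) simp_all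
  also note *
  also have "fps_agree n (euler_prod 4 n * euler_prod 4 n) (euler_mod2 4 * euler_mod2 4)"
    by (intro fps_agree_mult fps_agree_sym[OF euler_mod2_agree]) simp_all
  also have "euler_mod2 4 * euler_mod2 4 = euler_mod2 2 * euler_mod2 2 ^ 3"
    using euler_mod2_double[of 2] by (simp add: power2_eq_square power3_eq_cube mult_ac)
  finally have "fps_agree n (inverse (euler_mod2 2) * (euler_mod2 2 * ?S))
      (inverse (euler_mod2 2) * (euler_mod2 2 * euler_mod2 2 ^ 3))"
    by (rule fps_agree_mult[OF fps_agree_refl])
  moreover have "inverse (euler_mod2 2) * euler_mod2 2 = 1"
    using euler_mod2_nth_0[of 2] by (intro inverse_mult_eq_1) simp
  ultimately have "fps_agree n ?S (euler_mod2 2 ^ 3)"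
    by (simp only: mult.assoc[symmetric] mult_1_left)
  moreover have "?S = (\<Sum>j\<le>2 * n. fps_X ^ (j * Suc j))"
    by (simp add: q_def flip: power_mult)
  moreover have "euler_mod2 2 ^ 3 = euler_mod2 1 ^ 6"
    using euler_mod2_double[of 1] by (simp flip: power_mult)
  ultimately show ?thesis by (metis fps_agree_sym)
qed

text \<open>Indices prime to 6 merge the two branches of the pentagonal series into one sum.\<close>

lemma sum_coprime_6:
  fixes f :: "nat \<Rightarrow> 'a::comm_monoid_add"
  shows "(\<Sum>y | y \<le> 6 * n + 1 \<and> odd y \<and> \<not> 3 dvd y. f y) = f 1 + (\<Sum>s=1..n. f (6 * s + 1) + f (6 * s - 1))"
proof (induction n)
  case 0
  have "{y :: nat. y \<le> 6 * 0 + 1 \<and> odd y \<and> \<not> 3 dvd y} = {1}" by (auto simp: le_Suc_eq)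
  then show ?case by simp
next
  case (Suc n)
  have "{y. y \<le> 6 * Suc n + 1 \<and> odd y \<and> \<not> 3 dvd y} =
      insert (6 * Suc n + 1) (insert (6 * Suc n - 1) {y. y \<le> 6 * n + 1 \<and> odd y \<and> \<not> 3 dvd y})"
    by (auto; presburger)
  then show ?case using Suc by (simp add: add_ac)
qed

text \<open>Here \<open>q = fps_X ^ 3\<close>, signs disappear in characteristic 2, and \<open>(6 *
  s \<plusminus> 1)\<^sup>2 - 1 = 12 * s * (3 * s \<plusminus> 1)\<close> turns the pentagonal
  exponents into \<open>(y\<^sup>2 - 1) div 8\<close>.\<close>

lemma pentagonal_mod2:
  "fps_agree n (euler_mod2 3) (\<Sum>y | y \<le> 6 * n + 1 \<and> odd y \<and> \<not> 3 dvd y. fps_X ^ ((y\<^sup>2 - 1) div 8))"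
proof -
  define q :: "bit fps" where "q = fps_X ^ 3"
  let ?P = "\<lambda>s. \<Prod>k=Suc s..n. 1 - q ^ k"
  have P0: "?P 0 = euler_prod 3 n"
    by (simp add: euler_prod_def q_def flip: power_mult)
  have sign: "(-1) ^ s = (1 :: bit fps)" for s
  proof -
    have "(-1 :: bit fps) = 1 - 2" by simp
    also have "\<dots> = 1" unfolding two_bit_fps by simp
    finally show ?thesis by (simp only: power_one)
  qed
  have "fps_agree n ((-1) ^ s * ?P s * q ^ (s * n + s * Suc s div 2)) (if s = 0 then ?P 0 else 0)" for s
  proof (cases s)
    case (Suc r)
    have "s * Suc s div 2 > 0" using Suc by (simp add: div_greater_zero_iff)
    then have "n < 3 * (s * n + s * Suc s div 2)" using Suc by simp
    then have "fps_agree n ((-1) ^ s * ?P s * fps_X ^ (3 * (s * n + s * Suc s div 2))) 0"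
      by (rule fps_agree_mult_X_power)
    moreover have "s \<noteq> 0" using Suc by simp
    ultimately show ?thesis by (simp only: q_def power_mult if_False)
  qed simp
  then have "fps_agree n (\<Sum>s\<le>n. (-1) ^ s * ?P s * q ^ (s * n + s * Suc s div 2)) (\<Sum>s\<le>n. if s = 0 then ?P 0 else 0)"
    by (rule fps_agree_sum)
  then have *: "fps_agree n (1 + (\<Sum>s=1..n. q ^ (s * (3 * s + 1) div 2) + q ^ (s * (3 * s - 1) div 2))) (euler_prod 3 n)"
    unfolding shanks_pentagonal by (simp add: P0 sign)
  have exps: "((6 * s + 1)\<^sup>2 - 1) div 8 = 3 * (s * (3 * s + 1) div 2)"
    "((6 * s - 1)\<^sup>2 - 1) div 8 = 3 * (s * (3 * s - 1) div 2)" if s: "s \<ge> 1" for s :: nat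
  proof -
    obtain r where r: "s = Suc r" using s by (cases s) auto
    have "even (s * (3 * s + 1))" "even (s * (3 * s - 1))" using r by auto
    then obtain c d where cd: "s * (3 * s + 1) = 2 * c" "s * (3 * s - 1) = 2 * d" by (elim dvdE)
    have "(6 * s + 1)\<^sup>2 - 1 = 12 * (s * (3 * s + 1))" by (simp add: power2_eq_square algebra_simps)
    moreover have "(6 * s - 1)\<^sup>2 - 1 = 12 * (s * (3 * s - 1))"
      unfolding r by (simp add: power2_eq_square algebra_simps)
    ultimately show "((6 * s + 1)\<^sup>2 - 1) div 8 = 3 * (s * (3 * s + 1) div 2)"
      "((6 * s - 1)\<^sup>2 - 1) div 8 = 3 * (s * (3 * s - 1) div 2)"
      unfolding cd by simp_all
  qed
  have eq: "(\<Sum>y | y \<le> 6 * n + 1 \<and> odd y \<and> \<not> 3 dvd y. fps_X ^ ((y\<^sup>2 - 1) div 8)) =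
      1 + (\<Sum>s=1..n. q ^ (s * (3 * s + 1) div 2) + q ^ (s * (3 * s - 1) div 2))"
    unfolding sum_coprime_6 by (intro arg_cong2[of _ _ _ _ "(+)"] sum.cong)
      (simp_all only: atLeastAtMost_iff exps q_def power_mult[symmetric], simp_all)
  show ?thesis
    unfolding eq by (rule fps_agree_trans[OF euler_mod2_agree fps_agree_sym[OF *]]) simp
qed

text \<open>With \<open>x = 2 * j + 1\<close> the equation
  \<open>2 * x\<^sup>2 + y\<^sup>2 = 8 * n + 3\<close> becomes
  \<open>j * Suc j + (y\<^sup>2 - 1) div 8 = n\<close>; modulo 8 it forces both coordinates to be
  odd.\<close>

lemma theta_product_nth:
  "fps_nth (euler_mod2 1 ^ 6 * euler_mod2 3) n = of_nat (card (pos_reps (8 * n + 3)))"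
proof -
  let ?Y = "{y. y \<le> 6 * n + 1 \<and> odd y \<and> \<not> 3 dvd y}"
  let ?e = "\<lambda>(j, y). j * Suc j + (y\<^sup>2 - 1) div 8"
  have "fps_agree n (euler_mod2 1 ^ 6 * euler_mod2 3)
      ((\<Sum>j\<le>2 * n. fps_X ^ (j * Suc j)) * (\<Sum>y\<in>?Y. fps_X ^ ((y\<^sup>2 - 1) div 8)))"
    by (intro fps_agree_mult triangular_mod2 pentagonal_mod2)
  also have "(\<Sum>j\<le>2 * n. fps_X ^ (j * Suc j)) * (\<Sum>y\<in>?Y. fps_X ^ ((y\<^sup>2 - 1) div 8)) =
      (\<Sum>z\<in>{..2 * n} \<times> ?Y. fps_X ^ ?e z :: bit fps)"
    by (simp add: sum_product sum.cartesian_product power_add case_prod_beta)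
  finally have "fps_nth (euler_mod2 1 ^ 6 * euler_mod2 3) n =
      (\<Sum>z\<in>{..2 * n} \<times> ?Y. if n = ?e z then 1 else 0)"
    by (simp add: fps_agree_def fps_sum_nth fps_X_power_nth)
  also have "\<dots> = of_nat (card {z \<in> {..2 * n} \<times> ?Y. n = ?e z})"
    by (simp flip: sum.inter_filter)
  also have "card {z \<in> {..2 * n} \<times> ?Y. n = ?e z} = card (pos_reps (8 * n + 3))"
  proof (rule bij_betw_same_card, rule bij_betw_imageI)
    let ?f = "\<lambda>(j :: nat, y :: nat). (2 * j + 1, y)"
    show "inj_on ?f {z \<in> {..2 * n} \<times> ?Y. n = ?e z}" by (auto simp: inj_on_def)
    have key: "2 * (2 * j + 1)\<^sup>2 + y\<^sup>2 = 8 * n + 3 \<longleftrightarrow> n = ?e (j, y)" if "odd y" for j y :: nat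
    proof -
      have "y\<^sup>2 = 8 * ((y\<^sup>2 - 1) div 8) + 1"
        using odd_square_mod_8[OF that] by (metis add_diff_cancel_right' div_mult_mod_eq mult.commute nonzero_mult_div_cancel_left zero_neq_numeral)
      moreover have "2 * (2 * j + 1)\<^sup>2 = 8 * (j * Suc j) + 2"
        by (simp add: power2_eq_square algebra_simps)
      ultimately have "2 * (2 * j + 1)\<^sup>2 + y\<^sup>2 = 8 * ?e (j, y) + 3" by simp
      then show ?thesis by auto
    qed
    show "?f ` {z \<in> {..2 * n} \<times> ?Y. n = ?e z} = pos_reps (8 * n + 3)"
    proof (intro equalityI subsetI)
      fix z assume "z \<in> ?f ` {z \<in> {..2 * n} \<times> ?Y. n = ?e z}"
      then obtain j y where "z = (2 * j + 1, y)" "odd y" "\<not> 3 dvd y" "n = ?e (j, y)" by auto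
      then show "z \<in> pos_reps (8 * n + 3)" using key[of y j] by (simp add: pos_reps_def)
    next
      fix z assume "z \<in> pos_reps (8 * n + 3)"
      then obtain x y where z: "z = (x, y)" "2 * x\<^sup>2 + y\<^sup>2 = 8 * n + 3" "\<not> 3 dvd y"
        by (auto simp: pos_reps_def)
      have "odd (y\<^sup>2)" using z(2) by presburger
      then have y: "odd y" by simp
      have "odd x"
      proof
        assume "even x"
        then obtain r where "x = 2 * r" by blast
        then have "8 * r\<^sup>2 + y\<^sup>2 = 8 * n + 3" using z by (simp add: power_mult_distrib)
        from arg_cong[OF this, of "\<lambda>z. z mod 8"] show False using odd_square_mod_8[OF y] by simp
      qed
      then obtain j where x: "x = 2 * j + 1" by (elim oddE)
      have n: "n = ?e (j, y)" using z(2) key[OF y, of j] by (simp add: x)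
      then have "j \<le> 2 * n" by (cases j) auto
      moreover have "y \<le> 6 * n + 1"
      proof -
        have "y\<^sup>2 \<le> 8 * n + 3 - 2 * x\<^sup>2" using z(2) by simp
        also have "x\<^sup>2 \<ge> 1" using x by simp
        then have "8 * n + 3 - 2 * x\<^sup>2 \<le> 8 * n + 1" by simp
        also have "\<dots> \<le> (6 * n + 1)\<^sup>2" by (simp add: power2_eq_square algebra_simps)
        finally show ?thesis by (rule power2_le_imp_le) simp
      qed
      ultimately have "(j, y) \<in> {z \<in> {..2 * n} \<times> ?Y. n = ?e z}" using n y z(3) by simp
      then show "z \<in> ?f ` {z \<in> {..2 * n} \<times> ?Y. n = ?e z}" unfolding z(1) x by force
    qed
  qed
  finally show ?thesis .
qed

lemma even_bipart_count_iff: "even (bipart_count 8 3 n) \<longleftrightarrow> even (card (pos_reps (8 * n + 3)))"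
proof -
  have "(of_nat (bipart_count 8 3 n) :: bit) = of_nat (card (pos_reps (8 * n + 3)))"
    unfolding bipart_gf bipart_gf_mod2 by (rule theta_product_nth)
  then show ?thesis by (metis even_of_nat)
qed

lemma even_a2_iff: "even (a2 n) \<longleftrightarrow> even (card (pos_reps (8 * n + 3)))"
proof -
  have "(of_int (a2 n) :: bit) = of_nat (card (pos_reps (8 * n + 3)))"
    unfolding theta_product_nth[symmetric] a2_def euler_mod2_def
      fps_of_int_fps_power[symmetric] fps_of_int_fps_mult[symmetric] by simp
  then show ?thesis by (metis even_of_nat even_of_int_iff)
qed

section \<open>The parity of \<open>w2\<close> and the congruence for
  \<open>bipart_count 8 3\<close>\<close>

lemma eight_dvd_odd_square_minus_1: "odd n \<Longrightarrow> 8 dvd n\<^sup>2 - 1" for n :: nat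
  using odd_square_mod_8[of n] by (metis dvd_minus_mod)

text \<open>The first summand is odd by \<open>odd_card_pos_reps\<close>, as its index is the
  \<open>n\<close> with \<open>8 * n + 3 = 3 * p\<^sup>2\<close>. The second is a product of odd
  factors, since neither Legendre symbol vanishes.\<close>

lemma w2_even:
  fixes p :: nat
  assumes p: "prime p" "p \<ge> 5"
  shows "even (w2 p)"
proof -
  have "odd p" using p by (auto simp: prime_nat_iff dest: spec[of _ 2])
  then obtain c where c: "p\<^sup>2 - 1 = 8 * c" using eight_dvd_odd_square_minus_1 by blast
  then have c': "p\<^sup>2 = 8 * c + 1" using p by (metis One_nat_def Suc_diff_1 Suc_eq_plus1 pos2 prime_gt_0_nat zero_less_power)
  have "3 * (p\<^sup>2 - 1) div 8 = 3 * c" unfolding c by simp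
  moreover have eq3: "8 * (3 * c) + 3 = 3 * p\<^sup>2" by (simp add: c')
  ultimately have "odd (a2 (3 * (p\<^sup>2 - 1) div 8))"
    using odd_card_pos_reps[OF p] by (simp add: even_a2_iff)
  moreover have "odd (Legendre a (int p))" if "\<not> int p dvd a" for a
    using that by (auto simp: Legendre_def cong_0_iff)
  moreover have "\<not> int p dvd -6"
  proof
    assume "int p dvd -6"
    then have "int p dvd int (2 * 3)" by simp
    then have "p dvd 2 * 3" by (simp only: int_dvd_int_iff)
    then have "p dvd 2 \<or> p dvd 3" using p by (simp only: prime_dvd_mult_iff)
    then show False using p by (auto dest: dvd_imp_le)
  qed
  \<comment> \<open>With \<open>c = (p\<^sup>2 - 1) div 8\<close>, if \<open>p\<close> divided
    \<open>3 * c\<close>, it would divide \<open>3 * p\<^sup>2 - 24 * c = 3\<close>.\<close>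
  moreover have "\<not> int p dvd - (3 * ((int p)\<^sup>2 - 1) div 8)"
  proof
    have "(int p)\<^sup>2 = 8 * int c + 1" using c' by (metis of_nat_1 of_nat_add of_nat_mult of_nat_numeral of_nat_power)
    then have eq: "3 * ((int p)\<^sup>2 - 1) div 8 = 3 * int c" by simp
    assume "int p dvd - (3 * ((int p)\<^sup>2 - 1) div 8)"
    then have "int p dvd 3 * int c" by (simp only: eq dvd_minus_iff)
    then have "p dvd 3 * c" by (metis int_dvd_int_iff of_nat_mult of_nat_numeral)
    then have "p dvd 8 * (3 * c)" by (rule dvd_mult)
    moreover have "p dvd 3 * p\<^sup>2" by (simp add: power2_eq_square)
    then have "p dvd 8 * (3 * c) + 3" by (simp only: eq3)
    ultimately have "p dvd 3" by (metis dvd_add_right_iff)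
    then show False using p by (auto dest: dvd_imp_le)
  qed
  ultimately show ?thesis using \<open>odd p\<close> by (simp add: w2_def)
qed

text \<open>Here \<open>8 * ?N + 3\<close> is \<open>p ^ (4 * k + 3) * (8 * n + 3 * p)\<close>,
  whose second factor is prime to \<open>p\<close>, so \<open>even_card_pos_reps\<close>
  applies.\<close>

lemma even_bipart_count:
  fixes p :: nat
  assumes p: "prime p" "p \<ge> 5" and n: "\<not> p dvd n"
  shows "even (bipart_count 8 3 (p ^ (4 * k + 3) * n + 3 * (p ^ (4 * k + 4) - 1) div 8))"
proof -
  let ?N = "p ^ (4 * k + 3) * n + 3 * (p ^ (4 * k + 4) - 1) div 8"
  have "odd p" using p by (auto simp: prime_nat_iff dest: spec[of _ 2])
  \<comment> \<open>\<open>p ^ (4 * k + 4)\<close> is an odd square, so the subtraction and the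
    division by 8 in \<open>?N\<close> are exact.\<close>
  then obtain c where c: "(p ^ (2 * k + 2))\<^sup>2 - 1 = 8 * c"
    using eight_dvd_odd_square_minus_1[of "p ^ (2 * k + 2)"] by auto
  have sq: "(p ^ (2 * k + 2))\<^sup>2 = p ^ (4 * k + 4)"
  proof -
    have "(2 * k + 2) * 2 = 4 * k + 4" by simp
    then show ?thesis by (simp only: flip: power_mult)
  qed
  have "p ^ (4 * k + 4) \<ge> 1" using p by simp
  with c sq have c': "p ^ (4 * k + 4) = 8 * c + 1" by simp
  have "8 * ?N + 3 = 8 * (p ^ (4 * k + 3) * n) + 3 * p ^ (4 * k + 4)" by (simp only: c') simp
  also have "\<dots> = p ^ (4 * k + 3) * (8 * n + 3 * p)"
  proof -
    have "4 * k + 4 = Suc (4 * k + 3)" by simp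
    then have "p ^ (4 * k + 4) = p ^ (4 * k + 3) * p" by (simp only: power_Suc2)
    then show ?thesis by (simp only: distrib_left mult_ac)
  qed
  finally have N: "8 * ?N + 3 = p ^ (4 * k + 3) * (8 * n + 3 * p)" .
  have "\<not> p dvd 8 * n + 3 * p"
  proof
    assume "p dvd 8 * n + 3 * p"
    then have "p dvd 2 ^ 3 * n" by (simp add: dvd_add_left_iff)
    then have "p dvd 2 ^ 3" using p n prime_dvd_mult_iff by blast
    then have "p dvd 2" using p prime_dvd_power by blast
    then show False using p by (auto dest: dvd_imp_le)
  qed
  moreover have "(8 * ?N + 3) mod 8 = 3" by presburger
  ultimately have "even (card (pos_reps (8 * ?N + 3)))"
    unfolding N by (rule even_card_pos_reps[OF p])
  then show ?thesis by (simp only: even_bipart_count_iff)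
qed

theorem theorem1p12:
  fixes p :: nat
  assumes "prime p" and "p \<ge> 5"
  shows
    "([w2 p = 0] (mod 2) \<longrightarrow>
       (\<forall>n k :: nat. \<not> p dvd n \<longrightarrow>
         [bipart_count 8 3 (p ^ (4 * k + 3) * n + 3 * (p ^ (4 * k + 4) - 1) div 8) = 0] (mod 2)))
     \<and>
     (\<not> [w2 p = 0] (mod 2) \<longrightarrow>
       (\<forall>n k :: nat. \<not> p dvd n \<longrightarrow>
         [bipart_count 8 3 (p ^ (6 * k + 5) * n + 3 * (p ^ (6 * k + 6) - 1) div 8) = 0] (mod 2)))
     \<and>
     (\<not> [w2 p = 0] (mod 2) \<longrightarrow>
       (\<forall>n k :: nat.
         [w2 p = (int p)\<^sup>2 * Legendre (-6 * int n - 2 + ((int p)\<^sup>2 - 1) div 4) (int p)] (mod 2) \<longrightarrow>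
         [bipart_count 8 3 (p ^ (6 * k + 2) * n + 3 * (p ^ (6 * k + 2) - 1) div 8) = 0] (mod 2)))"
proof -
  have "[w2 p = 0] (mod 2)" using w2_even[OF assms] by (simp add: cong_0_iff)
  moreover have "[bipart_count 8 3 (p ^ (4 * k + 3) * n + 3 * (p ^ (4 * k + 4) - 1) div 8) = 0] (mod 2)"
    if "\<not> p dvd n" for n k
    using even_bipart_count[OF assms that] by (simp only: cong_0_iff)
  ultimately show ?thesis by blast
qed

end
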